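(* Let $a,b$ be integers such that either $b>a\ge 3$ or $(a,b)=(2,3)$, and set $q=b/a$. Consider the sub-Riemannian manifold $(\mathbb{R}^3,\mathcal{D},g)$ where $\mathcal{D}=\mathrm{span}\{X_1,X_2\}$, with $$X_1(x)=\partial_{x_1},\qquad X_2(x)=\partial_{x_2}+P(x)^2\,\partial_{x_3},\qquad P(x)=x_1^a-x_2^b,$$ and $g$ is the metric making $X_1,X_2$ orthonormal. Then, for every $\varepsilon>0$, the curve $\gamma_\varepsilon:[0,\varepsilon]\to\mathbb{R}^3$, $\gamma_\varepsilon(t)=(t^q,t,0)$, is a strictly abnormal and $C^1$-rigid curve which is not length-minimizing.
   Context: Horizontal curves: an absolutely continuous $\eta:[0,\tau]\to\mathbb{R}^3$ is horizontal if there is a control $u=(u_1,u_2)\in L^2([0,\tau],\mathbb{R}^2)$ with $\dot\eta=u_1X_1(\eta)+u_2X_2(\eta)$ a.e. Its length is $L_{\mathrm{sR}}(\eta)=\int_0^\tau\sqrt{u_1^2+u_2^2}\,dt$. A horizontal curve is length-minimizing if its length is at most that of every horizontal curve with the same endpoints. Abnormal: a horizontal curve $\eta:[0,\tau]\to\mathbb{R}^3$ with control $u$ is abnormal if there is an absolutely continuous $p=(p_1,p_2,p_3):[0,\tau]\to(\mathbb{R}^3)^*$ with $p(t)\neq0$ and $p(t)(X_i(\eta(t)))=0$ for $i=1,2$ and all $t\in[0,\tau]$, and satisfying the adjoint equation of the Pontryagin maximum principle, $\dot p_i=-u_2\,p_3\,\partial_{x_i}(P^2)(\eta)$ a.e.,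 $i=1,2,3$. Normal: $\eta$ is normal if there is $p:[0,\tau]\to(\mathbb{R}^3)^*$ such that $(\eta,p)$ solves the Hamiltonian system of $H(x,p)=\frac12p_1^2+\frac12h(x,p)^2$, $h(x,p)=p_2+p_3P(x)^2$, that is, $\dot x_i=\partial_{p_i}H$, $\dot p_i=-\partial_{x_i}H$ for $i=1,2,3$. Strictly abnormal: abnormal, and no reparameterization of the curve is normal. $C^1$-rigid: for a horizontal curve $\eta:[0,\tau]\to\mathbb{R}^3$ with control $u$ and for $\delta>0$, let $\mathcal U_{\eta,\delta}$ be the set of horizontal curves $\tilde\eta:[0,\tau]\to\mathbb{R}^3$, with control $\tilde u$, such that $\tilde\eta(0)=\eta(0)$, $\tilde\eta(\tau)=\eta(\tau)$, $\|\eta-\tilde\eta\|_\infty<\delta$ and $\|u-\tilde u\|_\infty<\delta$. The curve $\eta$ is $C^1$-rigid if there is $\delta>0$ such that every curve in $\mathcal U_{\eta,\delta}$ is a reparameterization of $\eta$. *)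

theory Defs
  imports "HOL-Analysis.Analysis" "HOL-Probability.Essential_Supremum"
begin

text \<open>
  Points, tangent vectors and covectors of \<open>\<real>\<^sup>3\<close> are all of type \<^typ>\<open>real ^ 3\<close>; the value of a
  covector \<open>p\<close> on a vector \<open>v\<close> is \<open>p \<bullet> v\<close>. Curves and controls are total functions on the reals, of
  which only the restriction to the parameter interval \<open>[0,\<tau>]\<close> is relevant. The notions below are
  relative to an arbitrary function \<open>P\<close>, which determines the frame \<open>X1\<close>, \<open>X2\<close>.
\<close>

definition X1 :: "real ^ 3 \<Rightarrow> real ^ 3" where
  "X1 x = axis 1 1"

definition X2 :: "(real ^ 3 \<Rightarrow> real) \<Rightarrow> real ^ 3 \<Rightarrow> real ^ 3" where
  "X2 P x = axis 2 1 + (P x)\<^sup>2 *\<^sub>R axis 3 1"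

definition partial_derivative :: "3 \<Rightarrow> (real ^ 3 \<Rightarrow> real) \<Rightarrow> real ^ 3 \<Rightarrow> real" where
  "partial_derivative i f x = deriv (\<lambda>s. f (x + s *\<^sub>R axis i 1)) 0"

text \<open>
  The library's \<^const>\<open>absolutely_continuous\<close> concerns measures; this is the classical notion for
  functions on \<open>[a,b]\<close>, with a finite family of non-overlapping subintervals given by the set \<open>I\<close>
  of its pairs of endpoints.
\<close>

definition abs_continuous_on_interval :: "real \<Rightarrow> real \<Rightarrow> (real \<Rightarrow> 'a::metric_space) \<Rightarrow> bool" where
  "abs_continuous_on_interval a b f \<longleftrightarrow>
     (\<forall>e>0. \<exists>d>0. \<forall>I. finite I \<and> (\<forall>(s, t)\<in>I. a \<le> s \<and> s \<le> t \<and> t \<le> b) \<and>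
        disjoint_family_on (\<lambda>(s, t). {s<..<t}) I \<and> (\<Sum>(s, t)\<in>I. t - s) < d \<longrightarrow>
        (\<Sum>(s, t)\<in>I. dist (f s) (f t)) < e)"

definition L2_control :: "real \<Rightarrow> (real \<Rightarrow> real ^ 2) \<Rightarrow> bool" where
  "L2_control \<tau> u \<longleftrightarrow>
     u \<in> borel_measurable (lebesgue_on {0..\<tau>}) \<and>
     integrable (lebesgue_on {0..\<tau>}) (\<lambda>t. (norm (u t))\<^sup>2)"

definition horizontal :: "(real ^ 3 \<Rightarrow> real) \<Rightarrow> real \<Rightarrow> (real \<Rightarrow> real ^ 3) \<Rightarrow> (real \<Rightarrow> real ^ 2) \<Rightarrow> bool"
  where
  "horizontal P \<tau> \<eta> u \<longleftrightarrow>
     0 < \<tau> \<and> abs_continuous_on_interval 0 \<tau> \<eta> \<and> L2_control \<tau> u \<and>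
     (AE t in lebesgue_on {0..\<tau>}.
        (\<eta> has_vector_derivative (u t $ 1 *\<^sub>R X1 (\<eta> t) + u t $ 2 *\<^sub>R X2 P (\<eta> t)))
          (at t within {0..\<tau>}))"

text \<open>
  Since \<open>X1\<close> and \<open>X2\<close> are linearly independent at every point, the control of a horizontal curve is
  unique up to null sets. Hence it does not matter whether the control is quantified existentially
  or universally in the notions below.
\<close>

lemma horizontal_control_unique:
  assumes "horizontal P \<tau> \<eta> u" and "horizontal P \<tau> \<eta> v"
  shows "AE t in lebesgue_on {0..\<tau>}. u t = v t"
proof -
  have "0 < \<tau>"
    using assms(1) by (simp add: horizontal_def)
  have "AE t in lebesgue_on {0..\<tau>}. t \<in> {0..\<tau>}"
    by (rule AE_I2) simp
  moreover have "AE t in lebesgue_on {0..\<tau>}.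
      (\<eta> has_vector_derivative (u t $ 1 *\<^sub>R X1 (\<eta> t) + u t $ 2 *\<^sub>R X2 P (\<eta> t))) (at t within {0..\<tau>})"
    using assms(1) by (simp add: horizontal_def)
  moreover have "AE t in lebesgue_on {0..\<tau>}.
      (\<eta> has_vector_derivative (v t $ 1 *\<^sub>R X1 (\<eta> t) + v t $ 2 *\<^sub>R X2 P (\<eta> t))) (at t within {0..\<tau>})"
    using assms(2) by (simp add: horizontal_def)
  ultimately show ?thesis
  proof eventually_elim
    case (elim t)
    have "u t $ 1 *\<^sub>R X1 (\<eta> t) + u t $ 2 *\<^sub>R X2 P (\<eta> t) = v t $ 1 *\<^sub>R X1 (\<eta> t) + v t $ 2 *\<^sub>R X2 P (\<eta> t)"
      using vector_derivative_unique_within_closed_interval[of 0 \<tau> t] elim \<open>0 < \<tau>\<close>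
      by (simp add: cbox_interval)
    then show ?case
      by (simp add: vec_eq_iff forall_3 forall_2 X1_def X2_def axis_def)
  qed
qed

definition sR_length :: "real \<Rightarrow> (real \<Rightarrow> real ^ 2) \<Rightarrow> real" where
  "sR_length \<tau> u = (LINT t|lebesgue_on {0..\<tau>}. sqrt ((u t $ 1)\<^sup>2 + (u t $ 2)\<^sup>2))"

definition length_minimizing :: "(real ^ 3 \<Rightarrow> real) \<Rightarrow> real \<Rightarrow> (real \<Rightarrow> real ^ 3) \<Rightarrow> bool" where
  "length_minimizing P \<tau> \<eta> \<longleftrightarrow>
     (\<exists>u. horizontal P \<tau> \<eta> u \<and>
       (\<forall>\<tau>' \<eta>' u'. horizontal P \<tau>' \<eta>' u' \<and> \<eta>' 0 = \<eta> 0 \<and> \<eta>' \<tau>' = \<eta> \<tau> \<longrightarrow>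
          sR_length \<tau> u \<le> sR_length \<tau>' u'))"

definition abnormal :: "(real ^ 3 \<Rightarrow> real) \<Rightarrow> real \<Rightarrow> (real \<Rightarrow> real ^ 3) \<Rightarrow> bool" where
  "abnormal P \<tau> \<eta> \<longleftrightarrow>
     (\<exists>u. horizontal P \<tau> \<eta> u \<and>
       (\<exists>p :: real \<Rightarrow> real ^ 3. abs_continuous_on_interval 0 \<tau> p \<and>
          (\<forall>t\<in>{0..\<tau>}. p t \<noteq> 0 \<and> p t \<bullet> X1 (\<eta> t) = 0 \<and> p t \<bullet> X2 P (\<eta> t) = 0) \<and>
          (\<forall>i. AE t in lebesgue_on {0..\<tau>}.
             ((\<lambda>s. p s $ i) has_real_derivative
                - u t $ 2 * p t $ 3 * partial_derivative i (\<lambda>x. (P x)\<^sup>2) (\<eta> t))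
               (at t within {0..\<tau>}))))"

definition sR_Hamiltonian :: "(real ^ 3 \<Rightarrow> real) \<Rightarrow> real ^ 3 \<Rightarrow> real ^ 3 \<Rightarrow> real" where
  "sR_Hamiltonian P x p = 1 / 2 * (p $ 1)\<^sup>2 + 1 / 2 * (p $ 2 + p $ 3 * (P x)\<^sup>2)\<^sup>2"

definition normal :: "(real ^ 3 \<Rightarrow> real) \<Rightarrow> real \<Rightarrow> (real \<Rightarrow> real ^ 3) \<Rightarrow> bool" where
  "normal P \<tau> \<eta> \<longleftrightarrow>
     (\<exists>p :: real \<Rightarrow> real ^ 3. \<forall>t\<in>{0..\<tau>}. \<forall>i.
        ((\<lambda>s. \<eta> s $ i) has_real_derivative
           partial_derivative i (\<lambda>q. sR_Hamiltonian P (\<eta> t) q) (p t)) (at t within {0..\<tau>}) \<and>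
        ((\<lambda>s. p s $ i) has_real_derivative
           - partial_derivative i (\<lambda>x. sR_Hamiltonian P x (p t)) (\<eta> t)) (at t within {0..\<tau>}))"

text \<open>
  \<open>reparameterization \<tau> \<eta> \<tau>' \<eta>'\<close>: the curve \<open>\<eta>'\<close> on \<open>[0,\<tau>']\<close> is \<open>\<eta>\<close>, a curve on \<open>[0,\<tau>]\<close>,
  precomposed with an increasing homeomorphism from \<open>[0,\<tau>']\<close> onto \<open>[0,\<tau>]\<close>.
\<close>

definition reparameterization ::
  "real \<Rightarrow> (real \<Rightarrow> real ^ 3) \<Rightarrow> real \<Rightarrow> (real \<Rightarrow> real ^ 3) \<Rightarrow> bool" where
  "reparameterization \<tau> \<eta> \<tau>' \<eta>' \<longleftrightarrow>
     (\<exists>\<phi>. continuous_on {0..\<tau>'} \<phi> \<and> strict_mono_on {0..\<tau>'} \<phi> \<and> \<phi> 0 = 0 \<and> \<phi> \<tau>' = \<tau> \<and>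
        (\<forall>t\<in>{0..\<tau>'}. \<eta>' t = \<eta> (\<phi> t)))"

definition strictly_abnormal :: "(real ^ 3 \<Rightarrow> real) \<Rightarrow> real \<Rightarrow> (real \<Rightarrow> real ^ 3) \<Rightarrow> bool" where
  "strictly_abnormal P \<tau> \<eta> \<longleftrightarrow>
     abnormal P \<tau> \<eta> \<and>
     \<not> (\<exists>\<tau>' \<eta>'. 0 < \<tau>' \<and> reparameterization \<tau> \<eta> \<tau>' \<eta>' \<and> normal P \<tau>' \<eta>')"

definition C1_neighbours ::
  "(real ^ 3 \<Rightarrow> real) \<Rightarrow> real \<Rightarrow> (real \<Rightarrow> real ^ 3) \<Rightarrow> (real \<Rightarrow> real ^ 2) \<Rightarrow> real \<Rightarrow> (real \<Rightarrow> real ^ 3) set"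
  where
  "C1_neighbours P \<tau> \<eta> u \<delta> =
     {\<eta>'. \<exists>u'. horizontal P \<tau> \<eta>' u' \<and> \<eta>' 0 = \<eta> 0 \<and> \<eta>' \<tau> = \<eta> \<tau> \<and>
        (SUP t\<in>{0..\<tau>}. ereal (norm (\<eta> t - \<eta>' t))) < ereal \<delta> \<and>
        esssup (lebesgue_on {0..\<tau>}) (\<lambda>t. ereal (norm (u t - u' t))) < ereal \<delta>}"

definition C1_rigid :: "(real ^ 3 \<Rightarrow> real) \<Rightarrow> real \<Rightarrow> (real \<Rightarrow> real ^ 3) \<Rightarrow> bool" where
  "C1_rigid P \<tau> \<eta> \<longleftrightarrow>
     (\<exists>u. horizontal P \<tau> \<eta> u \<and>
       (\<exists>\<delta>>0. \<forall>\<eta>'\<in>C1_neighbours P \<tau> \<eta> u \<delta>. reparameterization \<tau> \<eta> \<tau> \<eta>'))"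

definition P_poly :: "nat \<Rightarrow> nat \<Rightarrow> real ^ 3 \<Rightarrow> real" where
  "P_poly a b x = (x $ 1) ^ a - (x $ 2) ^ b"

definition power_curve :: "real \<Rightarrow> real \<Rightarrow> real ^ 3" where
  "power_curve q t = vector [t powr q, t, 0]"

end

theory Submission
  imports Defs
begin

text \<open>
  Horizontal curves are lifts of plane curves: the third coordinate satisfies \<open>x\<^sub>3' = P\<^sup>2 x\<^sub>2'\<close>. The power
  curve \<open>\<gamma>\<close> lies in the zero set of \<open>P\<close>, where \<open>P\<^sup>2\<close> vanishes together with its gradient.

  Hence the constant covector \<open>dx\<^sub>3\<close> makes \<open>\<gamma>\<close> abnormal (\<open>abnormal_of_zero_set\<close>), while a normal
  extremal inside the zero set is a straight line run at constant speed
  (\<open>normal_in_zero_set_straight\<close>), which no reparameterization of \<open>\<gamma>\<close> is, since \<open>q > 1\<close>.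

  For rigidity, a competitor with control close to that of \<open>\<gamma>\<close> moves strictly forward in \<open>x\<^sub>2\<close>, so
  \<open>x\<^sub>3\<close> cannot decrease. As it must return to \<open>0\<close>, the competitor stays in the zero set of \<open>P\<close> and
  therefore on \<open>\<gamma>\<close> (\<open>C1_rigid_of_zero_set\<close>, \<open>C1_rigid_power_curve\<close>). The passage from almost everywhere
  information on the derivative to monotonicity rests on the fundamental theorem of calculus for
  absolutely continuous functions (\<open>abs_continuous_integral\<close>).

  The curve is not minimizing because of its bend at the origin. Replacing its initial part up to
  time \<open>s\<close> by the chord saves a length of order \<open>s powr (2 q - 1)\<close>
  (\<open>chord_shorter_than_power_curve\<close>), and the lift arrives at the endpoint at a height
  \<open>E \<le> s ^ (2 b + 1)\<close> instead of \<open>0\<close> (\<open>reaches_along_segment\<close>). Near the endpoint, away from the origin,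
  \<open>P\<close> vanishes only to first order, so a small square loop of side \<open>r\<close> run against the direction of
  \<open>\<gamma>\<close> lowers the height by an amount of order \<open>r\<^sup>3\<close> (\<open>reaches_by_square_loop\<close>). Removing \<open>E\<close> thus
  costs a length of order \<open>s powr ((2 b + 1) / 3)\<close>. For \<open>b > a \<ge> 2\<close>
  the conditions on \<open>a\<close> and \<open>b\<close> amount to \<open>(2 b + 1) / 3 > 2 q - 1\<close>, so for small \<open>s\<close> the
  correction costs less than the chord saves.
\<close>

section \<open>Absolutely continuous functions\<close>

text \<open>
  Let \<open>N\<close> be the null set on which the derivative is unknown. Cover \<open>N\<close> by an open set \<open>U\<close> so small that
  absolute continuity bounds the total variation of \<open>f\<close> over disjoint intervals inside \<open>U\<close> by \<open>e / 2\<close>.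
  With a gauge that keeps intervals tagged in \<open>N\<close> inside \<open>U\<close>, and is fine enough for the
  differential quotient at every other tag, the telescoping sum of the increments of \<open>f\<close> over a
  tagged division is within \<open>e\<close> of the Riemann sum.
\<close>

lemma abs_continuous_integral:
  fixes f :: "real \<Rightarrow> 'a::banach"
  assumes "a \<le> b"
    and ac: "abs_continuous_on_interval a b f"
    and deriv: "AE t in lebesgue_on {a..b}. (f has_vector_derivative f' t) (at t within {a..b})"
  shows "(f' has_integral f b - f a) {a..b}"
proof -
  obtain N where "negligible N"
    and derivN: "\<And>t. t \<in> {a..b} \<Longrightarrow> t \<notin> N \<Longrightarrow>
      (f has_vector_derivative f' t) (at t within {a..b})"
  proof -
    have "AE t in lebesgue. t \<in> {a..b} \<longrightarrow> (f has_vector_derivative f' t) (at t within {a..b})"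
      using deriv by (subst (asm) AE_restrict_space_iff) auto
    then show thesis
      unfolding eventually_ae_filter_negligible using that by blast
  qed
  define g where "g t = (if t \<in> N then 0 else f' t)" for t
  have "(g has_integral f b - f a) (cbox a b)"
    unfolding has_integral
  proof (intro allI impI)
    fix e :: real
    assume "0 < e"
    define e' where "e' = e / (2 * (b - a + 1))"
    have "0 < e'" and e'_le: "e' * (b - a) \<le> e / 2"
      using \<open>0 < e\<close> \<open>a \<le> b\<close> by (auto simp: e'_def field_simps)
    from ac have "\<exists>d>0. \<forall>I. finite I \<and> (\<forall>(s, t)\<in>I. a \<le> s \<and> s \<le> t \<and> t \<le> b) \<and>
        disjoint_family_on (\<lambda>(s, t). {s<..<t}) I \<and> (\<Sum>(s, t)\<in>I. t - s) < d \<longrightarrow>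
        (\<Sum>(s, t)\<in>I. dist (f s) (f t)) < e / 2"
      unfolding abs_continuous_on_interval_def by (rule allE[of _ "e / 2"]) (use \<open>0 < e\<close> in simp)
    then obtain d where "0 < d" and d: "\<And>I. finite I \<Longrightarrow>
        (\<forall>(s, t)\<in>I. a \<le> s \<and> s \<le> t \<and> t \<le> b) \<Longrightarrow> disjoint_family_on (\<lambda>(s, t). {s<..<t}) I \<Longrightarrow>
        (\<Sum>(s, t)\<in>I. t - s) < d \<Longrightarrow> (\<Sum>(s, t)\<in>I. dist (f s) (f t)) < e / 2"
      by (elim exE conjE) presburger
    obtain U where "open U" "N \<subseteq> U" "U \<in> lmeasurable" "measure lebesgue U < d"
    proof -
      obtain U where U: "open U" "N \<subseteq> U" "(U - N) \<in> lmeasurable" "emeasure lebesgue (U - N) < ennreal d"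
        using sets_lebesgue_outer_open[of N d] \<open>negligible N\<close> \<open>0 < d\<close> negligible_imp_sets by blast
      have "(U - N) \<union> N \<in> lmeasurable"
        using U(3) negligible_imp_measurable[OF \<open>negligible N\<close>] by (rule fmeasurable.Un)
      moreover have "(U - N) \<union> N = U"
        using U(2) by blast
      ultimately have "U \<in> lmeasurable"
        by simp
      moreover have "measure lebesgue U = measure lebesgue (U - N)"
        using \<open>negligible N\<close> U(3) \<open>U \<in> lmeasurable\<close>
        by (simp add: measure_Diff_null_set negligible_iff_null_sets fmeasurableD)
      moreover have "measure lebesgue (U - N) < d"
        using U(3,4) \<open>0 < d\<close> by (simp add: emeasure_eq_measure2 ennreal_less_iff)
      ultimately show thesis
        using that U(1,2) by simp
    qed
    have "\<exists>r>0. (t \<in> N \<longrightarrow> ball t r \<subseteq> U) \<and> (t \<in> {a..b} - N \<longrightarrow>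
        (\<forall>y\<in>{a..b}. \<bar>y - t\<bar> < r \<longrightarrow> norm (f y - f t - (y - t) *\<^sub>R f' t) \<le> e' * \<bar>y - t\<bar>))" for t
    proof (cases "t \<in> N")
      case True
      then show ?thesis
        using \<open>open U\<close> \<open>N \<subseteq> U\<close> by (metis DiffD2 open_contains_ball subsetD)
    next
      case False
      show ?thesis
      proof (cases "t \<in> {a..b}")
        case True
        from derivN[OF True False] have "\<exists>r>0. \<forall>y\<in>{a..b}. norm (y - t) < r \<longrightarrow>
            norm (f y - f t - (y - t) *\<^sub>R f' t) \<le> e' * norm (y - t)"
          using \<open>0 < e'\<close> unfolding has_vector_derivative_def has_derivative_within_alt by blast
        then show ?thesis
          using False by auto
      qed (use False in \<open>auto intro: exI[of _ 1]\<close>)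
    qed
    then have "\<exists>r. \<forall>t. 0 < r t \<and> (t \<in> N \<longrightarrow> ball t (r t) \<subseteq> U) \<and> (t \<in> {a..b} - N \<longrightarrow>
        (\<forall>y\<in>{a..b}. \<bar>y - t\<bar> < r t \<longrightarrow> norm (f y - f t - (y - t) *\<^sub>R f' t) \<le> e' * \<bar>y - t\<bar>))"
      by (intro choice) blast
    then obtain r where r: "\<And>t. 0 < r t" "\<And>t. t \<in> N \<Longrightarrow> ball t (r t) \<subseteq> U"
      and r_deriv: "\<And>t y. t \<in> {a..b} \<Longrightarrow> t \<notin> N \<Longrightarrow> y \<in> {a..b} \<Longrightarrow> \<bar>y - t\<bar> < r t \<Longrightarrow>
          norm (f y - f t - (y - t) *\<^sub>R f' t) \<le> e' * \<bar>y - t\<bar>"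
      by blast
    define \<gamma> where "\<gamma> t = ball t (r t)" for t
    have gauge: "gauge \<gamma>"
      using r(1) by (auto simp: \<gamma>_def gauge_def)
    have fine: "norm ((\<Sum>(t, K)\<in>D. measure lborel K *\<^sub>R g t) - (f b - f a)) < e"
      if D: "D tagged_division_of cbox a b" and "\<gamma> fine D" for D
    proof -
      note Dd = tagged_division_ofD[OF D]
      have K: "Inf K \<le> t" "t \<le> Sup K" "a \<le> Inf K" "Sup K \<le> b"
          and K_eq: "{Inf K..Sup K} = K" and K_content: "measure lborel K = Sup K - Inf K"
          and K_gauge: "Inf K \<in> \<gamma> t" "Sup K \<in> \<gamma> t" "K \<subseteq> \<gamma> t"
        if tK: "(t, K) \<in> D" for t K
      proof -
        have "t \<in> K" "K \<subseteq> {a..b}" "K \<subseteq> \<gamma> t"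
          using Dd(2,3)[OF tK] \<open>\<gamma> fine D\<close> tK by (auto simp: fine_def)
        moreover obtain u v where "K = {u..v}"
          using Dd(4)[OF tK] by auto
        moreover from calculation have "Inf K = u" "Sup K = v" "u \<in> K" "v \<in> K" "u \<le> v"
          by auto
        ultimately show "Inf K \<le> t" "t \<le> Sup K" "a \<le> Inf K" "Sup K \<le> b"
          "{Inf K..Sup K} = K" "measure lborel K = Sup K - Inf K"
          "Inf K \<in> \<gamma> t" "Sup K \<in> \<gamma> t" "K \<subseteq> \<gamma> t"
          by (simp_all add: subset_iff)
      qed
      let ?err = "\<lambda>(t, K). measure lborel K *\<^sub>R g t - (f (Sup K) - f (Inf K))"
      let ?DN = "{x \<in> D. fst x \<in> N}" and ?DR = "{x \<in> D. fst x \<notin> N}"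
      let ?ends = "\<lambda>(t, K). (Inf K, Sup K)"
      have "finite D"
        by (rule Dd(1))
      have "(\<Sum>(t, K)\<in>D. measure lborel K *\<^sub>R g t) - (f b - f a) = (\<Sum>x\<in>D. ?err x)"
        using additive_tagged_division_1[OF \<open>a \<le> b\<close>, of D f] D
        by (simp add: sum_subtractf case_prod_unfold)
      also have "\<dots> = (\<Sum>x\<in>?DR. ?err x) + (\<Sum>x\<in>?DN. ?err x)"
        using \<open>finite D\<close> by (subst sum.union_disjoint[symmetric]) (auto intro!: sum.cong)
      finally have "norm ((\<Sum>(t, K)\<in>D. measure lborel K *\<^sub>R g t) - (f b - f a)) \<le>
          (\<Sum>x\<in>?DR. norm (?err x)) + (\<Sum>x\<in>?DN. norm (?err x))"
        using norm_triangle_mono[OF norm_sum norm_sum, of ?err ?DR ?err ?DN] by presburger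
      moreover have "(\<Sum>x\<in>?DR. norm (?err x)) \<le> e / 2"
      proof -
        have "norm (?err (t, K)) \<le> e' * measure lborel K" if "(t, K) \<in> ?DR" for t K
        proof -
          have tK: "(t, K) \<in> D" "t \<notin> N"
            using that by auto
          note K' = K[OF tK(1)]
          have "t \<in> {a..b}" "Inf K \<in> {a..b}" "Sup K \<in> {a..b}"
            using K' by auto
          moreover have "\<bar>Inf K - t\<bar> < r t" "\<bar>Sup K - t\<bar> < r t"
            using K_gauge(1,2)[OF tK(1)] by (simp_all add: \<gamma>_def dist_real_def abs_minus_commute)
          ultimately have 1: "norm (f (Sup K) - f t - (Sup K - t) *\<^sub>R f' t) \<le> e' * \<bar>Sup K - t\<bar>"
            and 2: "norm (f (Inf K) - f t - (Inf K - t) *\<^sub>R f' t) \<le> e' * \<bar>Inf K - t\<bar>"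
            using tK(2) by (auto intro: r_deriv)
          have "?err (t, K) = (f (Inf K) - f t - (Inf K - t) *\<^sub>R f' t) - (f (Sup K) - f t - (Sup K - t) *\<^sub>R f' t)"
            using tK(2) by (simp add: K_content[OF tK(1)] g_def algebra_simps)
          also have "norm \<dots> \<le> e' * \<bar>Inf K - t\<bar> + e' * \<bar>Sup K - t\<bar>"
            by (rule order_trans[OF norm_triangle_ineq4 add_mono[OF 2 1]])
          also have "\<dots> = e' * measure lborel K"
            using K' by (simp add: K_content[OF tK(1)] algebra_simps)
          finally show ?thesis .
        qed
        then have "(\<Sum>x\<in>?DR. norm (?err x)) \<le> (\<Sum>x\<in>?DR. e' * measure lborel (snd x))"
          by (intro sum_mono) auto
        also have "\<dots> \<le> (\<Sum>x\<in>D. e' * measure lborel (snd x))"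
          using \<open>finite D\<close> \<open>0 < e'\<close> by (intro sum_mono2) auto
        also have "\<dots> = e' * (b - a)"
          using additive_content_tagged_division[OF D] \<open>a \<le> b\<close>
          by (simp add: sum_distrib_left[symmetric] case_prod_unfold)
        finally show ?thesis
          using e'_le by linarith
      qed
      moreover have "(\<Sum>x\<in>?DN. norm (?err x)) < e / 2"
      proof -
        have disj: "{Inf K<..<Sup K} \<inter> {Inf L<..<Sup L} = {}"
          if "(t, K) \<in> D" "(s, L) \<in> D" "(t, K) \<noteq> (s, L)" for t K s L
        proof -
          have "interior K \<inter> interior L = {}"
            by (rule Dd(5)) (use that in auto)
          then show ?thesis
            using interior_atLeastAtMost_real[of "Inf K" "Sup K"] K_eq[OF that(1)]
              interior_atLeastAtMost_real[of "Inf L" "Sup L"] K_eq[OF that(2)] by simp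
        qed
        have inj: "inj_on ?ends D"
        proof (rule inj_onI)
          fix x y assume "x \<in> D" "y \<in> D" "?ends x = ?ends y"
          then obtain t K s L where tK: "(t, K) \<in> D" "(s, L) \<in> D" and eq: "Inf K = Inf L" "Sup K = Sup L"
            and xy: "x = (t, K)" "y = (s, L)"
            by (cases x, cases y) auto
          have "K = L"
            using K_eq[OF tK(1)] K_eq[OF tK(2)] unfolding eq by (rule trans[OF sym])
          moreover have "t = s"
          proof (rule ccontr)
            assume "t \<noteq> s"
            then have "{Inf K<..<Sup K} \<inter> {Inf L<..<Sup L} = {}"
              by (intro disj[OF tK]) simp
            then have "Inf K = Sup K"
              unfolding eq using K(1,2)[OF tK(2)] by simp
            then show False
              using \<open>t \<noteq> s\<close> K(1,2)[OF tK(1)] K(1,2)[OF tK(2)] eq by linarith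
          qed
          ultimately show "x = y"
            using xy by simp
        qed
        \<comment> \<open>Absolute continuity speaks of sets of pairs of endpoints, so distinct members of the
          division must not collapse to one pair; hence the injectivity above, which also covers
          degenerate intervals.\<close>
        let ?I = "?ends ` ?DN"
        have injN: "inj_on ?ends ?DN"
          using inj by (rule inj_on_subset) auto
        have "(\<Sum>(s, t)\<in>?I. dist (f s) (f t)) < e / 2"
        proof (rule d)
          show "finite ?I"
            using \<open>finite D\<close> by simp
          show I: "\<forall>(s, t)\<in>?I. a \<le> s \<and> s \<le> t \<and> t \<le> b"
            by (auto dest: K intro: order_trans[OF K(1) K(2)])
          show dis: "disjoint_family_on (\<lambda>(s, t). {s<..<t}) ?I"
            unfolding disjoint_family_on_def
          proof (intro ballI impI)
            fix x y assume "x \<in> ?I" "y \<in> ?I" "x \<noteq> y"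
            then obtain t K s L where "(t, K) \<in> D" "(s, L) \<in> D" "x = (Inf K, Sup K)" "y = (Inf L, Sup L)"
              by auto
            moreover from this \<open>x \<noteq> y\<close> have "(t, K) \<noteq> (s, L)"
              by auto
            ultimately show "(case x of (s, t) \<Rightarrow> {s<..<t}) \<inter> (case y of (s, t) \<Rightarrow> {s<..<t}) = {}"
              using disj by simp
          qed
          have "(\<Sum>(s, t)\<in>?I. t - s) = (\<Sum>x\<in>?I. measure lebesgue (case x of (s, t) \<Rightarrow> {s<..<t}))"
            using I by (intro sum.cong) auto
          also have "\<dots> = measure lebesgue (\<Union>x\<in>?I. case x of (s, t) \<Rightarrow> {s<..<t})"
            using \<open>finite D\<close> dis
            by (intro measure_finite_Union[symmetric])
              (auto simp: emeasure_lborel_Ioo order_trans[OF K(1) K(2)])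
          also have "\<dots> \<le> measure lebesgue U"
          proof (rule measure_mono_fmeasurable)
            show "(\<Union>x\<in>?I. case x of (s, t) \<Rightarrow> {s<..<t}) \<subseteq> U"
            proof clarsimp
              fix y t K assume "(t, K) \<in> D" "t \<in> N" "Inf K < y" "y < Sup K"
              then have "y \<in> K" "K \<subseteq> \<gamma> t" "\<gamma> t \<subseteq> U"
                using K_eq[of t K] K_gauge(3)[of t K] r(2)[of t] unfolding \<gamma>_def by auto
              then show "y \<in> U" by blast
            qed
          qed (use \<open>U \<in> lmeasurable\<close> \<open>finite D\<close> in \<open>auto intro!: sets.finite_UN\<close>)
          finally show "(\<Sum>(s, t)\<in>?I. t - s) < d"
            using \<open>measure lebesgue U < d\<close> by linarith
        qed
        moreover have "(\<Sum>x\<in>?DN. norm (?err x)) = (\<Sum>(s, t)\<in>?I. dist (f s) (f t))"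
          by (subst sum.reindex[OF injN])
            (auto intro!: sum.cong simp: g_def dist_norm norm_minus_commute)
        ultimately show ?thesis by simp
      qed
      ultimately show ?thesis by linarith
    qed
    show "\<exists>\<gamma>. gauge \<gamma> \<and> (\<forall>D. D tagged_division_of cbox a b \<and> \<gamma> fine D \<longrightarrow>
        norm ((\<Sum>(t, K)\<in>D. measure lborel K *\<^sub>R g t) - (f b - f a)) < e)"
      by (intro exI[of _ \<gamma>] conjI allI impI gauge) (elim conjE, rule fine)
  qed
  then have "(g has_integral f b - f a) {a..b}"
    by simp
  then show ?thesis
    by (rule has_integral_spike[OF \<open>negligible N\<close>, rotated]) (auto simp: g_def)
qed

lemma abs_continuousE:
  assumes "abs_continuous_on_interval a b f" "0 < e"
  obtains d where "0 < d"
    "\<And>I. finite I \<Longrightarrow> (\<And>s t. (s, t) \<in> I \<Longrightarrow> a \<le> s \<and> s \<le> t \<and> t \<le> b) \<Longrightarrow>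
        disjoint_family_on (\<lambda>(s, t). {s<..<t}) I \<Longrightarrow> (\<Sum>(s, t)\<in>I. t - s) < d \<Longrightarrow>
        (\<Sum>(s, t)\<in>I. dist (f s) (f t)) < e"
proof -
  from assms obtain d where "0 < d" and d: "\<forall>I. finite I \<and> (\<forall>(s, t)\<in>I. a \<le> s \<and> s \<le> t \<and> t \<le> b) \<and>
        disjoint_family_on (\<lambda>(s, t). {s<..<t}) I \<and> (\<Sum>(s, t)\<in>I. t - s) < d \<longrightarrow>
        (\<Sum>(s, t)\<in>I. dist (f s) (f t)) < e"
    unfolding abs_continuous_on_interval_def by blast
  show thesis
  proof (rule that[OF \<open>0 < d\<close>])
    fix I assume "finite I" "\<And>s t. (s, t) \<in> I \<Longrightarrow> a \<le> s \<and> s \<le> t \<and> t \<le> b"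
      "disjoint_family_on (\<lambda>(s, t). {s<..<t}) I" "(\<Sum>(s, t)\<in>I. t - s) < d"
    then show "(\<Sum>(s, t)\<in>I. dist (f s) (f t)) < e"
      by (intro d[THEN spec, THEN mp]) auto
  qed
qed

lemma abs_continuousI:
  assumes "\<And>e. 0 < e \<Longrightarrow> \<exists>d>0. \<forall>I. finite I \<longrightarrow> (\<forall>s t. (s, t) \<in> I \<longrightarrow> a \<le> s \<and> s \<le> t \<and> t \<le> b) \<longrightarrow>
      disjoint_family_on (\<lambda>(s, t). {s<..<t}) I \<longrightarrow> (\<Sum>(s, t)\<in>I. t - s) < d \<longrightarrow>
      (\<Sum>(s, t)\<in>I. dist (f s) (f t)) < e"
  shows "abs_continuous_on_interval a b f"
  unfolding abs_continuous_on_interval_def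
proof (intro allI impI)
  fix e :: real assume "0 < e"
  from assms[OF this] obtain d where "0 < d" and d: "\<forall>I. finite I \<longrightarrow>
      (\<forall>s t. (s, t) \<in> I \<longrightarrow> a \<le> s \<and> s \<le> t \<and> t \<le> b) \<longrightarrow>
      disjoint_family_on (\<lambda>(s, t). {s<..<t}) I \<longrightarrow> (\<Sum>(s, t)\<in>I. t - s) < d \<longrightarrow>
      (\<Sum>(s, t)\<in>I. dist (f s) (f t)) < e"
    by blast
  show "\<exists>d>0. \<forall>I. finite I \<and> (\<forall>(s, t)\<in>I. a \<le> s \<and> s \<le> t \<and> t \<le> b) \<and>
        disjoint_family_on (\<lambda>(s, t). {s<..<t}) I \<and> (\<Sum>(s, t)\<in>I. t - s) < d \<longrightarrow>
        (\<Sum>(s, t)\<in>I. dist (f s) (f t)) < e"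
  proof (intro exI conjI allI impI)
    fix I assume "finite I \<and> (\<forall>(s, t)\<in>I. a \<le> s \<and> s \<le> t \<and> t \<le> b) \<and>
        disjoint_family_on (\<lambda>(s, t). {s<..<t}) I \<and> (\<Sum>(s, t)\<in>I. t - s) < d"
    then show "(\<Sum>(s, t)\<in>I. dist (f s) (f t)) < e"
      by (intro d[THEN spec, THEN mp, THEN mp, THEN mp, THEN mp]) auto
  qed (rule \<open>0 < d\<close>)
qed

lemma abs_continuous_on_subinterval:
  assumes "abs_continuous_on_interval a b f" "a \<le> c" "d \<le> b"
  shows "abs_continuous_on_interval c d f"
proof (rule abs_continuousI)
  fix e :: real assume "0 < e"
  from abs_continuousE[OF assms(1) this] obtain r where "0 < r" and
    r: "\<And>I. finite I \<Longrightarrow> (\<And>s t. (s, t) \<in> I \<Longrightarrow> a \<le> s \<and> s \<le> t \<and> t \<le> b) \<Longrightarrow>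
        disjoint_family_on (\<lambda>(s, t). {s<..<t}) I \<Longrightarrow> (\<Sum>(s, t)\<in>I. t - s) < r \<Longrightarrow>
        (\<Sum>(s, t)\<in>I. dist (f s) (f t)) < e"
    by metis
  show "\<exists>r>0. \<forall>I. finite I \<longrightarrow> (\<forall>s t. (s, t) \<in> I \<longrightarrow> c \<le> s \<and> s \<le> t \<and> t \<le> d) \<longrightarrow>
      disjoint_family_on (\<lambda>(s, t). {s<..<t}) I \<longrightarrow> (\<Sum>(s, t)\<in>I. t - s) < r \<longrightarrow>
      (\<Sum>(s, t)\<in>I. dist (f s) (f t)) < e"
  proof (intro exI[of _ r] conjI allI impI)
    fix I assume I: "finite I" "\<forall>s t. (s, t) \<in> I \<longrightarrow> c \<le> s \<and> s \<le> t \<and> t \<le> d"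
      "disjoint_family_on (\<lambda>(s, t). {s<..<t}) I" "(\<Sum>(s, t)\<in>I. t - s) < r"
    show "(\<Sum>(s, t)\<in>I. dist (f s) (f t)) < e"
    proof (rule r[OF I(1) _ I(3,4)])
      fix s t assume "(s, t) \<in> I"
      then show "a \<le> s \<and> s \<le> t \<and> t \<le> b"
        using I(2)[THEN spec, THEN spec, of s t] assms(2,3) by auto
    qed
  qed (rule \<open>0 < r\<close>)
qed

lemma abs_continuous_on_component:
  fixes f :: "real \<Rightarrow> real ^ 'n"
  assumes "abs_continuous_on_interval a b f"
  shows "abs_continuous_on_interval a b (\<lambda>t. f t $ i)"
proof (rule abs_continuousI)
  fix e :: real assume "0 < e"
  from abs_continuousE[OF assms(1) this] obtain r where "0 < r" and
    r: "\<And>I. finite I \<Longrightarrow> (\<And>s t. (s, t) \<in> I \<Longrightarrow> a \<le> s \<and> s \<le> t \<and> t \<le> b) \<Longrightarrow>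
        disjoint_family_on (\<lambda>(s, t). {s<..<t}) I \<Longrightarrow> (\<Sum>(s, t)\<in>I. t - s) < r \<Longrightarrow>
        (\<Sum>(s, t)\<in>I. dist (f s) (f t)) < e"
    by metis
  show "\<exists>r>0. \<forall>I. finite I \<longrightarrow> (\<forall>s t. (s, t) \<in> I \<longrightarrow> a \<le> s \<and> s \<le> t \<and> t \<le> b) \<longrightarrow>
      disjoint_family_on (\<lambda>(s, t). {s<..<t}) I \<longrightarrow> (\<Sum>(s, t)\<in>I. t - s) < r \<longrightarrow>
      (\<Sum>(s, t)\<in>I. dist (f s $ i) (f t $ i)) < e"
  proof (intro exI[of _ r] conjI allI impI)
    fix I assume I: "finite I" "\<forall>s t. (s, t) \<in> I \<longrightarrow> a \<le> s \<and> s \<le> t \<and> t \<le> b"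
      "disjoint_family_on (\<lambda>(s, t). {s<..<t}) I" "(\<Sum>(s, t)\<in>I. t - s) < r"
    have "(\<Sum>(s, t)\<in>I. dist (f s $ i) (f t $ i)) \<le> (\<Sum>(s, t)\<in>I. dist (f s) (f t))"
      by (intro sum_mono) (auto simp: dist_vec_nth_le)
    also have "\<dots> < e"
      by (rule r[OF I(1) I(2)[THEN spec, THEN spec, THEN mp] I(3,4)])
    finally show "(\<Sum>(s, t)\<in>I. dist (f s $ i) (f t $ i)) < e" .
  qed (rule \<open>0 < r\<close>)
qed

lemma abs_continuous_imp_continuous_on:
  assumes "abs_continuous_on_interval a b f"
  shows "continuous_on {a..b} f"
  unfolding continuous_on_iff
proof (intro ballI allI impI)
  fix x e :: real assume "x \<in> {a..b}" "0 < e"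
  from abs_continuousE[OF assms(1) \<open>0 < e\<close>] obtain r where "0 < r" and
    r: "\<And>I. finite I \<Longrightarrow> (\<And>s t. (s, t) \<in> I \<Longrightarrow> a \<le> s \<and> s \<le> t \<and> t \<le> b) \<Longrightarrow>
        disjoint_family_on (\<lambda>(s, t). {s<..<t}) I \<Longrightarrow> (\<Sum>(s, t)\<in>I. t - s) < r \<Longrightarrow>
        (\<Sum>(s, t)\<in>I. dist (f s) (f t)) < e"
    by metis
  have near: "dist (f s) (f t) < e" if "a \<le> s" "s \<le> t" "t \<le> b" "t - s < r" for s t
    using r[of "{(s, t)}"] that by (simp add: disjoint_family_on_def)
  show "\<exists>d>0. \<forall>x'\<in>{a..b}. dist x' x < d \<longrightarrow> dist (f x') (f x) < e"
  proof (intro exI[of _ r] conjI ballI impI)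
    fix y assume "y \<in> {a..b}" "dist y x < r"
    then show "dist (f y) (f x) < e"
      using near[of x y] near[of y x] \<open>x \<in> {a..b}\<close>
      by (cases "x \<le> y") (auto simp: dist_real_def dist_commute)
  qed (rule \<open>0 < r\<close>)
qed

lemma lipschitz_imp_abs_continuous:
  fixes f :: "real \<Rightarrow> 'a::metric_space"
  assumes "C-lipschitz_on {a..b} f"
  shows "abs_continuous_on_interval a b f"
proof (rule abs_continuousI)
  fix e :: real assume "0 < e"
  have "0 \<le> C"
    using assms by (rule lipschitz_on_nonneg)
  have "(\<Sum>(s, t)\<in>I. dist (f s) (f t)) < e"
    if I: "\<forall>s t. (s, t) \<in> I \<longrightarrow> a \<le> s \<and> s \<le> t \<and> t \<le> b" and less: "(\<Sum>(s, t)\<in>I. t - s) < e / (C + 1)" for I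
  proof -
    have "(\<Sum>(s, t)\<in>I. dist (f s) (f t)) \<le> (\<Sum>(s, t)\<in>I. (C + 1) * (t - s))"
    proof (intro sum_mono, clarify)
      fix s t assume "(s, t) \<in> I"
      then have "a \<le> s" "s \<le> t" "t \<le> b"
        using I by auto
      then have "dist (f s) (f t) \<le> C * (t - s)"
        using lipschitz_onD[OF assms, of s t] by (auto simp: dist_real_def)
      then show "dist (f s) (f t) \<le> (C + 1) * (t - s)"
        using \<open>s \<le> t\<close> by (simp add: algebra_simps)
    qed
    also have "\<dots> = (C + 1) * (\<Sum>(s, t)\<in>I. t - s)"
      by (simp add: sum_distrib_left case_prod_unfold)
    also have "\<dots> < e"
      using less \<open>0 \<le> C\<close> by (simp add: field_simps)
    finally show ?thesis .
  qed
  then show "\<exists>d>0. \<forall>I. finite I \<longrightarrow> (\<forall>s t. (s, t) \<in> I \<longrightarrow> a \<le> s \<and> s \<le> t \<and> t \<le> b) \<longrightarrow>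
      disjoint_family_on (\<lambda>(s, t). {s<..<t}) I \<longrightarrow> (\<Sum>(s, t)\<in>I. t - s) < d \<longrightarrow>
      (\<Sum>(s, t)\<in>I. dist (f s) (f t)) < e"
    using \<open>0 < e\<close> \<open>0 \<le> C\<close> by (intro exI[of _ "e / (C + 1)"]) simp
qed

text \<open>
  The bound is only known almost everywhere, so the derivative is replaced by \<open>m\<close> on the exceptional
  null set before integrating.
\<close>

lemma abs_continuous_increment_ge:
  fixes f :: "real \<Rightarrow> real"
  assumes ac: "abs_continuous_on_interval a b f"
    and deriv: "AE t in lebesgue_on {a..b}. (f has_vector_derivative f' t) (at t within {a..b})"
    and ge: "AE t in lebesgue_on {a..b}. m \<le> f' t"
    and st: "a \<le> s" "s \<le> t" "t \<le> b"
  shows "m * (t - s) \<le> f t - f s"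
proof -
  let ?g = "\<lambda>x. if m \<le> f' x then f' x else m"
  have "AE x in lebesgue_on {s..t}. (f has_vector_derivative ?g x) (at x within {s..t})"
  proof -
    have "AE x in lebesgue_on {a..b}. m \<le> f' x \<and> (f has_vector_derivative f' x) (at x within {a..b})"
      using deriv ge by eventually_elim blast
    then have "AE x in lebesgue. x \<in> {a..b} \<longrightarrow>
        m \<le> f' x \<and> (f has_vector_derivative f' x) (at x within {a..b})"
      by (subst (asm) AE_restrict_space_iff) auto
    then have "AE x in lebesgue. x \<in> {s..t} \<longrightarrow> (f has_vector_derivative ?g x) (at x within {s..t})"
    proof eventually_elim
      case (elim x)
      then show ?case
        using st by (auto intro!: has_vector_derivative_within_subset[of f _ x "{a..b}" "{s..t}"])
    qed
    then show ?thesis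
      by (subst AE_restrict_space_iff) auto
  qed
  then have g: "(?g has_integral f t - f s) {s..t}"
    using abs_continuous_on_subinterval[OF ac st(1,3)] st(2) by (intro abs_continuous_integral)
  have "((\<lambda>_. m) has_integral m * (t - s)) {s..t}"
    using has_integral_const_real[of m s t] st by (simp add: mult.commute)
  from has_integral_le[OF this g] show ?thesis
    by simp
qed

section \<open>Horizontal curves and their length\<close>

lemma vector_3_eq: "(vector [x, y, z] :: real ^ 3) = x *\<^sub>R axis 1 1 + y *\<^sub>R axis 2 1 + z *\<^sub>R axis 3 1"
  by (simp add: vec_eq_iff forall_3 axis_def)

lemma vec_3_eqI:
  fixes v w :: "real ^ 3"
  assumes "v $ 1 = w $ 1" "v $ 2 = w $ 2" "v $ 3 = w $ 3"
  shows "v = w"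
  using assms by (simp add: vec_eq_iff forall_3)

lemma has_vector_derivative_vector_3:
  assumes "(f has_real_derivative f') F" "(g has_real_derivative g') F" "(h has_real_derivative h') F"
  shows "((\<lambda>t. vector [f t, g t, h t] :: real ^ 3) has_vector_derivative vector [f', g', h']) F"
  unfolding vector_3_eq using assms
  by (intro has_vector_derivative_add bounded_linear.has_vector_derivative[OF bounded_linear_scaleR_left])
    (simp_all add: has_real_derivative_iff_has_vector_derivative)

lemma frame_combination: "c *\<^sub>R X1 x + d *\<^sub>R X2 P x = vector [c, d, d * (P x)\<^sup>2]"
  by (rule vec_3_eqI) (simp_all add: X1_def X2_def axis_def)

lemma has_real_derivative_component:
  fixes f :: "real \<Rightarrow> real ^ 'n"
  assumes "(f has_vector_derivative f') F"
  shows "((\<lambda>t. f t $ i) has_real_derivative f' $ i) F"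
  using bounded_linear.has_vector_derivative[OF bounded_linear_vec_nth assms]
  by (simp add: has_real_derivative_iff_has_vector_derivative)

lemma norm_vec_2: "norm (v :: real ^ 2) = sqrt ((v $ 1)\<^sup>2 + (v $ 2)\<^sup>2)"
  by (simp add: norm_vec_def L2_set_def sum_2)

lemma integrable_lebesgue_on_bounded:
  fixes f :: "real \<Rightarrow> real"
  assumes "f \<in> borel_measurable borel" "\<And>t. t \<in> {a..b} \<Longrightarrow> \<bar>f t\<bar> \<le> K"
  shows "integrable (lebesgue_on {a..b}) f"
proof -
  interpret finite_measure "lebesgue_on {a..b}"
    by (rule finite_measure_lebesgue_on) auto
  show ?thesis
    using assms by (intro integrable_const_bound[of _ K] AE_I2 measurable_restrict_space1)
      (auto intro: measurable_completion)
qed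

text \<open>
  Both absolute continuity and square integrability come from bounds, which survive concatenation;
  all curves constructed below are obtained through this criterion.
\<close>

lemma horizontal_lipschitzI:
  assumes "0 < \<tau>" and "C-lipschitz_on {0..\<tau>} \<eta>"
    and "u \<in> borel_measurable borel" and "\<And>t. t \<in> {0..\<tau>} \<Longrightarrow> norm (u t) \<le> K"
    and "AE t in lebesgue_on {0..\<tau>}.
        (\<eta> has_vector_derivative (u t $ 1 *\<^sub>R X1 (\<eta> t) + u t $ 2 *\<^sub>R X2 P (\<eta> t)))
          (at t within {0..\<tau>})"
  shows "horizontal P \<tau> \<eta> u"
proof -
  have "integrable (lebesgue_on {0..\<tau>}) (\<lambda>t. (norm (u t))\<^sup>2)"
    using assms(3,4)
    by (intro integrable_lebesgue_on_bounded[of _ _ _ "K\<^sup>2"]) (auto intro!: power_mono)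
  moreover have "u \<in> borel_measurable (lebesgue_on {0..\<tau>})"
    using assms(3) by (intro measurable_restrict_space1 measurable_completion) simp
  ultimately show ?thesis
    using assms lipschitz_imp_abs_continuous by (auto simp: horizontal_def L2_control_def)
qed

lemma sR_length_eq_has_integral:
  assumes "u \<in> borel_measurable borel" "\<And>t. t \<in> {0..\<tau>} \<Longrightarrow> norm (u t) \<le> K"
    and "((\<lambda>t. norm (u t)) has_integral L) {0..\<tau>}"
  shows "sR_length \<tau> u = L"
proof -
  have "integrable (lebesgue_on {0..\<tau>}) (\<lambda>t. norm (u t))"
    using assms(1,2) by (intro integrable_lebesgue_on_bounded[of _ _ _ K]) auto
  then have "sR_length \<tau> u = integral {0..\<tau>} (\<lambda>t. norm (u t))"
    by (simp add: sR_length_def norm_vec_2[symmetric] lebesgue_integral_eq_integral)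
  then show ?thesis
    using assms(3) by (simp add: integral_unique)
qed

lemma vector_derivative_bounded_imp_lipschitz:
  fixes \<eta> :: "real \<Rightarrow> 'a::real_normed_vector"
  assumes "\<And>t. t \<in> {a..b} \<Longrightarrow> (\<eta> has_vector_derivative v t) (at t within {a..b})"
    and "\<And>t. t \<in> {a..b} \<Longrightarrow> norm (v t) \<le> K" and "0 \<le> K"
  shows "K-lipschitz_on {a..b} \<eta>"
proof (rule bounded_derivative_imp_lipschitz)
  fix t assume "t \<in> {a..b}"
  then show "(\<eta> has_derivative (\<lambda>x. x *\<^sub>R v t)) (at t within {a..b})"
    using assms(1) by (simp add: has_vector_derivative_def)
  show "onorm (\<lambda>x. x *\<^sub>R v t) \<le> K"
    using assms(2)[OF \<open>t \<in> {a..b}\<close>] by (simp add: onorm_scaleR_left[OF bounded_linear_ident] onorm_id)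
qed (use assms(3) in auto)

section \<open>The power curve\<close>

definition power_control :: "real \<Rightarrow> real \<Rightarrow> real ^ 2" where
  "power_control q t = vector [q * t powr (q - 1), 1]"

lemma power_curve_nth [simp]:
  "power_curve q t $ 1 = t powr q" "power_curve q t $ 2 = t" "power_curve q t $ 3 = 0"
  by (simp_all add: power_curve_def)

lemma power_control_nth [simp]:
  "power_control q t $ 1 = q * t powr (q - 1)" "power_control q t $ 2 = 1"
  by (simp_all add: power_control_def)

lemma P_poly_vector [simp]: "P_poly a b (vector [x, y, z]) = x ^ a - y ^ b"
  by (simp add: P_poly_def)

lemma P_poly_continuous: "continuous_on UNIV (P_poly a b)"
  unfolding P_poly_def[abs_def] by (intro continuous_intros)

lemma P_poly_differentiable: "P_poly a b differentiable (at x)"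
proof -
  have "(\<lambda>x :: real ^ 3. x $ i) differentiable (at x)" for i
    by (rule bounded_linear_imp_differentiable[OF bounded_linear_vec_nth])
  then show ?thesis
    unfolding P_poly_def[abs_def] by (intro differentiable_diff differentiable_power)
qed

lemma P_poly_power_curve:
  assumes "0 \<le> t" "0 < a" "0 < b"
  shows "P_poly a b (power_curve (real b / real a) t) = 0"
proof (cases "t = 0")
  case False
  then have "(t powr (real b / real a)) ^ a = t powr (real b / real a * real a)"
    by (simp add: powr_realpow[symmetric] powr_powr)
  also have "\<dots> = t ^ b"
    using False assms by (simp add: powr_realpow)
  finally show ?thesis
    by (simp add: P_poly_def)
qed (use assms in \<open>simp add: P_poly_def zero_power\<close>)

text \<open>
  The difference quotient at \<open>0\<close> is \<open>t powr (q - 1)\<close>, which tends to \<open>0\<close> as \<open>q > 1\<close>.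
\<close>

lemma has_real_derivative_powr_at_0:
  assumes "1 < q"
  shows "((\<lambda>t. t powr q) has_real_derivative 0) (at 0 within {0..})"
proof -
  have "((\<lambda>t. t powr (q - 1)) \<longlongrightarrow> 0 powr (q - 1)) (at 0 within {0..})"
    using continuous_on_powr'[of "{0::real..}" "\<lambda>t. t" "\<lambda>_. q - 1"] assms
    unfolding continuous_on_def by (force dest: bspec[of _ _ 0])
  moreover have "\<forall>\<^sub>F t in at 0 within {0..}. (t powr q - 0 powr q) / (t - 0) = t powr (q - 1)"
    by (auto simp: eventually_at_filter powr_diff)
  ultimately show ?thesis
    unfolding has_field_derivative_iff using assms by (simp add: tendsto_cong)
qed

lemma has_real_derivative_powr_within:
  assumes "1 < q" "0 \<le> t"
  shows "((\<lambda>t. t powr q) has_real_derivative q * t powr (q - 1)) (at t within {0..\<tau>})"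
proof (cases "t = 0")
  case True
  then show ?thesis
    using has_field_derivative_subset[OF has_real_derivative_powr_at_0[OF assms(1)], of "{0..\<tau>}"] assms(1)
    by auto
next
  case False
  then show ?thesis
    using assms by (auto intro!: derivative_eq_intros)
qed

lemma has_vector_derivative_power_curve:
  assumes "1 < q" "0 \<le> t" "P (power_curve q t) = 0"
  shows "(power_curve q has_vector_derivative
      power_control q t $ 1 *\<^sub>R X1 (power_curve q t) + power_control q t $ 2 *\<^sub>R X2 P (power_curve q t))
      (at t within {0..\<tau>})"
proof -
  have "((\<lambda>t. vector [t powr q, t, 0] :: real ^ 3) has_vector_derivative
      vector [q * t powr (q - 1), 1, 0]) (at t within {0..\<tau>})"
    by (intro has_vector_derivative_vector_3 has_real_derivative_powr_within assms(1,2))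
      (auto intro!: derivative_eq_intros)
  then show ?thesis
    unfolding frame_combination using assms(3) by (simp add: power_curve_def[abs_def])
qed

lemma power_control_measurable [measurable]: "power_control q \<in> borel_measurable borel"
proof -
  have "power_control q = (\<lambda>t. (q * t powr (q - 1)) *\<^sub>R axis 1 1 + axis 2 1)"
    by (simp add: fun_eq_iff vec_eq_iff forall_2 axis_def)
  then show ?thesis
    by simp
qed

lemma norm_power_control: "norm (power_control q t) = sqrt (1 + (q * t powr (q - 1))\<^sup>2)"
  by (simp add: norm_vec_2 add.commute)

lemma norm_power_control_le:
  assumes "1 < q" "t \<in> {0..\<tau>}"
  shows "norm (power_control q t) \<le> norm (power_control q \<tau>)"
  unfolding norm_power_control using assms by (auto intro!: power_mono mult_left_mono powr_mono2)

lemma horizontal_power_curve: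
  assumes "1 < q" "0 < \<tau>" "\<And>t. 0 \<le> t \<Longrightarrow> P (power_curve q t) = 0"
  shows "horizontal P \<tau> (power_curve q) (power_control q)"
proof -
  have deriv: "(power_curve q has_vector_derivative
      power_control q t $ 1 *\<^sub>R X1 (power_curve q t) + power_control q t $ 2 *\<^sub>R X2 P (power_curve q t))
      (at t within {0..\<tau>})" if "t \<in> {0..\<tau>}" for t
    using has_vector_derivative_power_curve[OF assms(1), of t P \<tau>] assms(3) that by auto
  have "(norm (power_control q \<tau>))-lipschitz_on {0..\<tau>} (power_curve q)"
  proof (rule vector_derivative_bounded_imp_lipschitz[OF deriv])
    fix t assume t: "t \<in> {0..\<tau>}"
    have "norm (power_control q t $ 1 *\<^sub>R X1 (power_curve q t) + power_control q t $ 2 *\<^sub>R X2 P (power_curve q t))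
      = norm (power_control q t)"
      unfolding frame_combination using t assms(3)[of t]
      by (simp add: norm_vec_def L2_set_def sum_3 sum_2)
    then show "norm (power_control q t $ 1 *\<^sub>R X1 (power_curve q t) +
        power_control q t $ 2 *\<^sub>R X2 P (power_curve q t)) \<le> norm (power_control q \<tau>)"
      using norm_power_control_le[OF assms(1) t] by simp
  qed auto
  then show ?thesis
    using deriv assms(1,2) norm_power_control_le[OF assms(1)]
    by (intro horizontal_lipschitzI AE_I2) auto
qed

section \<open>Strict abnormality\<close>

lemma has_derivative_along_axis:
  fixes f :: "real ^ 3 \<Rightarrow> real"
  assumes "f differentiable (at x)"
  shows "\<exists>D. ((\<lambda>s. f (x + s *\<^sub>R axis i 1)) has_real_derivative D) (at 0)"
proof -
  have "(\<lambda>s. x + s *\<^sub>R axis i 1) differentiable (at (0::real))"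
    by (intro derivative_intros)
  moreover have "f differentiable (at (x + 0 *\<^sub>R axis i 1))"
    using assms by simp
  ultimately have "(f \<circ> (\<lambda>s. x + s *\<^sub>R axis i 1)) differentiable (at 0)"
    by (rule differentiable_chain_at)
  then show ?thesis
    by (simp add: real_differentiable_def comp_def)
qed

text \<open>
  \<open>P\<close> enters \<open>H\<close> only through \<open>P\<^sup>2\<close>, whose gradient \<open>2 P \<nabla>P\<close> vanishes with \<open>P\<close>. This makes
  constant covectors solve both adjoint equations along curves in the zero set of \<open>P\<close>.
\<close>

lemma partial_derivative_square_at_zero:
  assumes "P differentiable (at x)" "P x = 0"
  shows "partial_derivative i (\<lambda>y. (P y)\<^sup>2) x = 0"
    and "partial_derivative i (\<lambda>y. sR_Hamiltonian P y p) x = 0"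
proof -
  obtain D where D: "((\<lambda>s. P (x + s *\<^sub>R axis i 1)) has_real_derivative D) (at 0)"
    using has_derivative_along_axis[OF assms(1)] by blast
  show "partial_derivative i (\<lambda>y. (P y)\<^sup>2) x = 0"
    unfolding partial_derivative_def
    by (rule DERIV_imp_deriv) (rule derivative_eq_intros D refl | simp add: assms(2))+
  show "partial_derivative i (\<lambda>y. sR_Hamiltonian P y p) x = 0"
    unfolding partial_derivative_def sR_Hamiltonian_def
    by (rule DERIV_imp_deriv) (rule derivative_eq_intros D refl | simp add: assms(2))+
qed

lemma partial_derivative_Hamiltonian_covector:
  assumes "P x = 0"
  shows "partial_derivative 1 (\<lambda>p. sR_Hamiltonian P x p) p = p $ 1"
    and "partial_derivative 2 (\<lambda>p. sR_Hamiltonian P x p) p = p $ 2"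
  unfolding partial_derivative_def sR_Hamiltonian_def
  by (rule DERIV_imp_deriv, auto intro!: derivative_eq_intros simp: assms axis_def)+

text \<open>
  The constant covector \<open>dx\<^sub>3\<close> annihilates the frame where \<open>P = 0\<close>.
\<close>

lemma abnormal_of_zero_set:
  assumes "horizontal P \<tau> \<eta> u" "\<And>t. t \<in> {0..\<tau>} \<Longrightarrow> P (\<eta> t) = 0" "\<And>x. P differentiable (at x)"
  shows "abnormal P \<tau> \<eta>"
  unfolding abnormal_def
proof (intro exI[of _ u] conjI exI[of _ "\<lambda>_. axis 3 1"] ballI allI)
  show "abs_continuous_on_interval 0 \<tau> (\<lambda>_. axis 3 1 :: real ^ 3)"
    by (rule lipschitz_imp_abs_continuous[of 0]) (simp add: lipschitz_on_def)
  fix t assume "t \<in> {0..\<tau>}"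
  then show "axis 3 1 \<bullet> X2 P (\<eta> t) = 0"
    using assms(2) by (simp add: X2_def inner_vec_def sum_3 axis_def)
  show "axis 3 1 \<bullet> X1 (\<eta> t) = 0" "(axis 3 1 :: real ^ 3) \<noteq> 0"
    by (simp_all add: X1_def inner_vec_def sum_3 axis_def vec_eq_iff)
next
  fix i :: 3
  show "AE t in lebesgue_on {0..\<tau>}. ((\<lambda>s. axis 3 1 $ i) has_real_derivative
      - u t $ 2 * axis 3 1 $ 3 * partial_derivative i (\<lambda>x. (P x)\<^sup>2) (\<eta> t)) (at t within {0..\<tau>})"
  proof (rule AE_I2)
    fix t assume "t \<in> space (lebesgue_on {0..\<tau>})"
    then have "partial_derivative i (\<lambda>x. (P x)\<^sup>2) (\<eta> t) = 0"
      using assms(2,3) by (intro partial_derivative_square_at_zero) auto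
    then show "((\<lambda>s. axis 3 1 $ i) has_real_derivative
      - u t $ 2 * axis 3 1 $ 3 * partial_derivative i (\<lambda>x. (P x)\<^sup>2) (\<eta> t)) (at t within {0..\<tau>})"
      by simp
  qed
qed (rule assms(1))

text \<open>
  On the zero set the Hamiltonian equations degenerate to \<open>p' = 0\<close>, \<open>x\<^sub>1' = p\<^sub>1\<close>, \<open>x\<^sub>2' = p\<^sub>2\<close>.
\<close>

lemma normal_in_zero_set_straight:
  assumes "normal P \<tau> \<eta>" "\<And>t. t \<in> {0..\<tau>} \<Longrightarrow> P (\<eta> t) = 0" "\<And>x. P differentiable (at x)"
  obtains c d where "\<And>t. t \<in> {0..\<tau>} \<Longrightarrow> \<eta> t $ 1 = \<eta> 0 $ 1 + c * t"
    and "\<And>t. t \<in> {0..\<tau>} \<Longrightarrow> \<eta> t $ 2 = \<eta> 0 $ 2 + d * t"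
proof -
  from assms(1) obtain p where \<eta>': "\<And>t i. t \<in> {0..\<tau>} \<Longrightarrow> ((\<lambda>s. \<eta> s $ i) has_real_derivative
        partial_derivative i (\<lambda>q. sR_Hamiltonian P (\<eta> t) q) (p t)) (at t within {0..\<tau>})"
    and p': "\<And>t i. t \<in> {0..\<tau>} \<Longrightarrow> ((\<lambda>s. p s $ i) has_real_derivative
        - partial_derivative i (\<lambda>x. sR_Hamiltonian P x (p t)) (\<eta> t)) (at t within {0..\<tau>})"
    unfolding normal_def by blast
  have p_const: "p t $ i = p 0 $ i" if "t \<in> {0..\<tau>}" for t i
  proof -
    have "((\<lambda>s. p s $ i) has_real_derivative 0) (at s within {0..\<tau>})" if "s \<in> {0..\<tau>}" for s
      using p'[OF that, of i] partial_derivative_square_at_zero(2)[of P "\<eta> s" i "p s"] assms(2,3) that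
      by simp
    from has_field_derivative_zero_constant[OF _ this] obtain c where "\<And>s. s \<in> {0..\<tau>} \<Longrightarrow> p s $ i = c"
      by (metis convex_real_interval(5))
    then show ?thesis
      using that by simp
  qed
  have lin: "\<eta> t $ i = \<eta> 0 $ i + p 0 $ i * t"
    if "t \<in> {0..\<tau>}" and i: "\<And>s. s \<in> {0..\<tau>} \<Longrightarrow>
      partial_derivative i (\<lambda>q. sR_Hamiltonian P (\<eta> s) q) (p s) = p s $ i" for t i
  proof -
    have "((\<lambda>s. \<eta> s $ i - p 0 $ i * s) has_real_derivative 0) (at s within {0..\<tau>})" if "s \<in> {0..\<tau>}" for s
      using \<eta>'[OF that, of i] i[OF that] p_const[OF that, of i]
      by (auto intro!: derivative_eq_intros)
    from has_field_derivative_zero_constant[OF _ this] obtain c where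
      "\<And>s. s \<in> {0..\<tau>} \<Longrightarrow> \<eta> s $ i - p 0 $ i * s = c"
      by (metis convex_real_interval(5))
    from this[of t] this[of 0] show ?thesis
      using that(1) by simp
  qed
  show thesis
    by (rule that[of "p 0 $ 1" "p 0 $ 2"])
      (intro lin partial_derivative_Hamiltonian_covector assms(2); assumption)+
qed

text \<open>
  A normal reparameterization would be affine in its first two coordinates, so \<open>\<phi>\<close> and \<open>\<phi> powr q\<close>
  would both be linear; halving the time then gives \<open>2 powr q = 2\<close>.
\<close>

lemma strictly_abnormal_power_curve:
  assumes "1 < q" "0 < \<tau>" and zero: "\<And>t. 0 \<le> t \<Longrightarrow> P (power_curve q t) = 0"
    and diff: "\<And>x. P differentiable (at x)"
  shows "strictly_abnormal P \<tau> (power_curve q)"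
  unfolding strictly_abnormal_def
proof (intro conjI notI)
  show "abnormal P \<tau> (power_curve q)"
    using abnormal_of_zero_set[of P \<tau> "power_curve q", OF horizontal_power_curve] assms by auto
next
  assume "\<exists>\<tau>' \<eta>'. 0 < \<tau>' \<and> reparameterization \<tau> (power_curve q) \<tau>' \<eta>' \<and> normal P \<tau>' \<eta>'"
  then obtain \<tau>' \<eta>' \<phi> where "0 < \<tau>'" and normal: "normal P \<tau>' \<eta>'"
    and \<phi>: "strict_mono_on {0..\<tau>'} \<phi>" "\<phi> 0 = 0" "\<phi> \<tau>' = \<tau>"
    and \<eta>': "\<And>t. t \<in> {0..\<tau>'} \<Longrightarrow> \<eta>' t = power_curve q (\<phi> t)"
    unfolding reparameterization_def by blast
  have \<phi>_nonneg: "0 \<le> \<phi> t" if "t \<in> {0..\<tau>'}" for t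
    using strict_mono_onD[OF \<phi>(1), of 0 t] \<phi>(2) that \<open>0 < \<tau>'\<close> by (cases "t = 0") auto
  have zero': "P (\<eta>' t) = 0" if "t \<in> {0..\<tau>'}" for t
    using \<eta>'[OF that] zero[OF \<phi>_nonneg[OF that]] by simp
  obtain c d where x1: "\<And>t. t \<in> {0..\<tau>'} \<Longrightarrow> \<eta>' t $ 1 = \<eta>' 0 $ 1 + c * t"
    and x2: "\<And>t. t \<in> {0..\<tau>'} \<Longrightarrow> \<eta>' t $ 2 = \<eta>' 0 $ 2 + d * t"
    using normal_in_zero_set_straight[OF normal zero' diff] by blast
  have start: "\<eta>' 0 = power_curve q 0"
    using \<eta>'[of 0] \<phi>(2) \<open>0 < \<tau>'\<close> by simp
  have c: "\<phi> t powr q = c * t" and d: "\<phi> t = d * t" if "t \<in> {0..\<tau>'}" for t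
    using x1[OF that] x2[OF that] \<eta>'[OF that] start \<open>1 < q\<close> by simp_all
  have "\<phi> (\<tau>' / 2) = \<tau> / 2"
    using d[of "\<tau>' / 2"] d[of \<tau>'] \<phi>(3) \<open>0 < \<tau>'\<close> by simp
  moreover have "\<tau> powr q = c * \<tau>'" "\<phi> (\<tau>' / 2) powr q = c * \<tau>' / 2"
    using c[of "\<tau>' / 2"] c[of \<tau>'] \<phi>(3) \<open>0 < \<tau>'\<close> by simp_all
  ultimately have "(\<tau> / 2) powr q = \<tau> powr q / 2"
    by metis
  then have "\<tau> powr q / 2 powr q = \<tau> powr q / 2"
    using \<open>0 < \<tau>\<close> by (simp add: powr_divide)
  then have "2 powr q = (2::real)"
    using \<open>0 < \<tau>\<close> by (simp add: field_simps)
  then have "2 powr q = (2::real) powr 1"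
    by simp
  then show False
    using \<open>1 < q\<close> by (subst (asm) powr_inj) auto
qed

section \<open>Rigidity\<close>

text \<open>
  If the control of a competitor is uniformly within \<open>1/2\<close> of a control with second component \<open>1\<close>, then
  its own second component is at least \<open>1/2\<close>. So \<open>x\<^sub>2\<close> is strictly increasing, and \<open>x\<^sub>3\<close>, with velocity
  \<open>u\<^sub>2 P\<^sup>2 \<ge> 0\<close>, is nondecreasing. As \<open>x\<^sub>3\<close> has equal end values it is constant, which forces
  \<open>P = 0\<close> along the competitor. Rigidity thus reduces to a uniqueness question for curves in the zero
  set of \<open>P\<close>, posed as the last hypothesis.
\<close>

lemma C1_rigid_of_zero_set:
  assumes hor: "horizontal P \<tau> \<eta> u" and u2: "\<And>t. t \<in> {0..\<tau>} \<Longrightarrow> u t $ 2 = 1"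
    and endpoints: "\<eta> 0 $ 3 = \<eta> \<tau> $ 3"
    and cont: "continuous_on UNIV P"
    and unique: "\<And>\<eta>'. continuous_on {0..\<tau>} \<eta>' \<Longrightarrow> \<eta>' 0 = \<eta> 0 \<Longrightarrow> \<eta>' \<tau> = \<eta> \<tau> \<Longrightarrow>
        strict_mono_on {0..\<tau>} (\<lambda>t. \<eta>' t $ 2) \<Longrightarrow> (\<And>t. t \<in> {0..\<tau>} \<Longrightarrow> P (\<eta>' t) = 0) \<Longrightarrow>
        (\<And>t. t \<in> {0..\<tau>} \<Longrightarrow> \<eta>' t $ 3 = \<eta> 0 $ 3) \<Longrightarrow> reparameterization \<tau> \<eta> \<tau> \<eta>'"
  shows "C1_rigid P \<tau> \<eta>"
  unfolding C1_rigid_def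
proof (intro exI[of _ u] conjI exI[of _ "1/2 :: real"] ballI)
  fix \<eta>' assume "\<eta>' \<in> C1_neighbours P \<tau> \<eta> u (1/2)"
  then obtain u' where hor': "horizontal P \<tau> \<eta>' u'" and ends: "\<eta>' 0 = \<eta> 0" "\<eta>' \<tau> = \<eta> \<tau>"
    and close: "esssup (lebesgue_on {0..\<tau>}) (\<lambda>t. ereal (norm (u t - u' t))) < ereal (1/2)"
    unfolding C1_neighbours_def by blast
  have "0 < \<tau>" and ac: "abs_continuous_on_interval 0 \<tau> \<eta>'"
    and deriv: "AE t in lebesgue_on {0..\<tau>}.
      (\<eta>' has_vector_derivative vector [u' t $ 1, u' t $ 2, u' t $ 2 * (P (\<eta>' t))\<^sup>2]) (at t within {0..\<tau>})"
    using hor' by (auto simp: horizontal_def frame_combination)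
  have in_Icc: "AE t in lebesgue_on {0..\<tau>}. t \<in> {0..\<tau>}"
    by (rule AE_I2) simp
  have u'2: "AE t in lebesgue_on {0..\<tau>}. 1/2 \<le> u' t $ 2"
    using esssup_AE[of "\<lambda>t. ereal (norm (u t - u' t))" "lebesgue_on {0..\<tau>}"] in_Icc
  proof eventually_elim
    case (elim t)
    then have "norm (u t - u' t) < 1/2"
      using le_less_trans[OF elim(1) close] by simp
    then have "\<bar>u t $ 2 - u' t $ 2\<bar> < 1/2"
      using component_le_norm_cart[of "u t - u' t" 2] by simp
    then show ?case
      unfolding u2[OF elim(2)] by linarith
  qed
  have deriv2: "AE t in lebesgue_on {0..\<tau>}.
      ((\<lambda>t. \<eta>' t $ 2) has_vector_derivative u' t $ 2) (at t within {0..\<tau>})"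
    using deriv
  proof eventually_elim
    case (elim t)
    then show ?case
      using has_real_derivative_component[of \<eta>' _ _ 2]
      by (fastforce simp: has_real_derivative_iff_has_vector_derivative)
  qed
  have deriv3: "AE t in lebesgue_on {0..\<tau>}.
      ((\<lambda>t. \<eta>' t $ 3) has_vector_derivative u' t $ 2 * (P (\<eta>' t))\<^sup>2) (at t within {0..\<tau>})"
    using deriv
  proof eventually_elim
    case (elim t)
    then show ?case
      using has_real_derivative_component[of \<eta>' _ _ 3]
      by (fastforce simp: has_real_derivative_iff_has_vector_derivative)
  qed
  have incr2: "1/2 * (t - s) \<le> \<eta>' t $ 2 - \<eta>' s $ 2" if "0 \<le> s" "s \<le> t" "t \<le> \<tau>" for s t
    using abs_continuous_increment_ge[OF abs_continuous_on_component[OF ac] deriv2 u'2 that] .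
  have mono: "strict_mono_on {0..\<tau>} (\<lambda>t. \<eta>' t $ 2)"
  proof (rule strict_mono_onI)
    fix s t assume "s \<in> {0..\<tau>}" "t \<in> {0..\<tau>}" "s < t"
    then show "\<eta>' s $ 2 < \<eta>' t $ 2"
      using incr2[of s t] by simp
  qed
  have "AE t in lebesgue_on {0..\<tau>}. 0 \<le> u' t $ 2 * (P (\<eta>' t))\<^sup>2"
    using u'2 by eventually_elim simp
  then have mono3: "0 * (t - s) \<le> \<eta>' t $ 3 - \<eta>' s $ 3" if "0 \<le> s" "s \<le> t" "t \<le> \<tau>" for s t
    using that by (rule abs_continuous_increment_ge[OF abs_continuous_on_component[OF ac] deriv3])
  have const3: "\<eta>' t $ 3 = \<eta> 0 $ 3" if "t \<in> {0..\<tau>}" for t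
    using mono3[of 0 t] mono3[of t \<tau>] endpoints ends that by auto
  have cont': "continuous_on {0..\<tau>} \<eta>'"
    using ac by (rule abs_continuous_imp_continuous_on)
  have "AE t in lebesgue_on {0..\<tau>}. (P (\<eta>' t))\<^sup>2 = 0"
    using deriv3 u'2 in_Icc
  proof eventually_elim
    case (elim t)
    have "((\<lambda>t. \<eta>' t $ 3) has_vector_derivative 0) (at t within {0..\<tau>})"
      by (rule has_vector_derivative_transform[OF elim(3) const3 has_vector_derivative_const])
    then have "u' t $ 2 * (P (\<eta>' t))\<^sup>2 = 0"
      using elim(1,3) \<open>0 < \<tau>\<close>
      by (intro vector_derivative_unique_within_closed_interval[of 0 \<tau> t "\<lambda>t. \<eta>' t $ 3"]) auto
    then show ?case
      using elim(2) by auto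
  qed
  then obtain N where N: "negligible N" "\<And>t. t \<in> {0..\<tau>} - N \<Longrightarrow> (P (\<eta>' t))\<^sup>2 = 0"
    by (subst (asm) AE_restrict_space_iff) (auto simp: eventually_ae_filter_negligible)
  have "((\<lambda>t. (P (\<eta>' t))\<^sup>2) has_integral 0) (cbox 0 \<tau>)"
    using has_integral_spike[OF N(1), of "cbox 0 \<tau>" "\<lambda>t. (P (\<eta>' t))\<^sup>2" "\<lambda>_. 0" 0] N(2) by auto
  moreover have "continuous_on (cbox 0 \<tau>) (\<lambda>t. (P (\<eta>' t))\<^sup>2)"
    using cont cont' by (auto intro!: continuous_intros continuous_on_compose2[of UNIV P])
  ultimately have zero: "P (\<eta>' t) = 0" if "t \<in> {0..\<tau>}" for t
    using has_integral_0_cbox_imp_0[of 0 \<tau> "\<lambda>t. (P (\<eta>' t))\<^sup>2" t] that \<open>0 < \<tau>\<close> by auto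
  show "reparameterization \<tau> \<eta> \<tau> \<eta>'"
    by (rule unique[OF cont' ends mono zero const3])
qed (use hor in auto)

text \<open>
  On the zero set \<open>x\<^sub>1 ^ a = x\<^sub>2 ^ b\<close>. For even \<open>a\<close> there is also the branch \<open>x\<^sub>1 < 0\<close>, but
  a curve on which \<open>x\<^sub>2 > 0\<close> after the start cannot change branches, and the endpoint lies on the positive one.
\<close>

lemma C1_rigid_power_curve:
  assumes "0 < a" "a < b" "q = real b / real a" "0 < \<tau>"
  shows "C1_rigid (P_poly a b) \<tau> (power_curve q)"
proof (rule C1_rigid_of_zero_set[of _ _ _ "power_control q"])
  have "1 < q"
    using assms by simp
  then show "horizontal (P_poly a b) \<tau> (power_curve q) (power_control q)"
    using assms by (intro horizontal_power_curve) (auto simp: P_poly_power_curve)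
  fix \<eta>' assume cont: "continuous_on {0..\<tau>} \<eta>'"
    and ends: "\<eta>' 0 = power_curve q 0" "\<eta>' \<tau> = power_curve q \<tau>"
    and mono: "strict_mono_on {0..\<tau>} (\<lambda>t. \<eta>' t $ 2)"
    and zero: "\<And>t. t \<in> {0..\<tau>} \<Longrightarrow> P_poly a b (\<eta>' t) = 0"
    and x3: "\<And>t. t \<in> {0..\<tau>} \<Longrightarrow> \<eta>' t $ 3 = power_curve q 0 $ 3"
  have x2_pos: "0 < \<eta>' t $ 2" if "0 < t" "t \<le> \<tau>" for t
    using strict_mono_onD[OF mono, of 0 t] that ends by auto
  have x1_nonzero: "\<eta>' t $ 1 \<noteq> 0" if "0 < t" "t \<le> \<tau>" for t
    using zero[of t] x2_pos[OF that] that assms(1) by (auto simp: P_poly_def zero_power)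
  have x1_pos: "0 < \<eta>' t $ 1" if t: "0 < t" "t \<le> \<tau>" for t
  proof (rule ccontr)
    assume "\<not> 0 < \<eta>' t $ 1"
    moreover have "0 \<le> \<eta>' \<tau> $ 1"
      using ends by simp
    moreover have "continuous_on {t..\<tau>} (\<lambda>t. \<eta>' t $ 1)"
      using t by (intro continuous_intros continuous_on_subset[OF cont]) auto
    ultimately obtain s where "t \<le> s" "s \<le> \<tau>" "\<eta>' s $ 1 = 0"
      using IVT'[of "\<lambda>t. \<eta>' t $ 1" t 0 \<tau>] t by auto
    then show False
      using x1_nonzero[of s] t by simp
  qed
  have "\<eta>' t = power_curve q (\<eta>' t $ 2)" if "t \<in> {0..\<tau>}" for t
  proof (cases "t = 0")
    case True
    then show ?thesis
      using ends by simp
  next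
    case False
    then have pos: "0 < \<eta>' t $ 2" "0 < \<eta>' t $ 1"
      using x1_pos x2_pos that by auto
    have "P_poly a b (power_curve q (\<eta>' t $ 2)) = 0"
      using assms pos by (simp add: P_poly_power_curve)
    then have "(\<eta>' t $ 1) ^ a = ((\<eta>' t $ 2) powr q) ^ a"
      using zero[OF that] by (simp add: P_poly_def)
    then have "\<eta>' t $ 1 = (\<eta>' t $ 2) powr q"
      using power_eq_imp_eq_base[of _ a] pos assms(1) by (metis less_imp_le powr_ge_zero)
    then show ?thesis
      using x3[OF that] by (intro vec_3_eqI) auto
  qed
  moreover have "continuous_on {0..\<tau>} (\<lambda>t. \<eta>' t $ 2)"
    using cont by (intro continuous_intros)
  ultimately show "reparameterization \<tau> (power_curve q) \<tau> \<eta>'"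
    unfolding reparameterization_def using mono ends
    by (intro exI[of _ "\<lambda>t. \<eta>' t $ 2"]) auto
qed (auto simp: P_poly_continuous)

section \<open>Concatenation of horizontal curves\<close>

text \<open>
  Joining \<open>x\<close> to \<open>y\<close> by a horizontal curve of length \<open>L\<close>, restricted to Lipschitz curves with bounded
  control that satisfy the equation off finitely many times: unlike for general horizontal curves,
  concatenation is then immediate. The degenerate case \<open>\<tau> = 0\<close> is included so that the relation is
  reflexive, which spares case distinctions when a piece of a concatenation has length zero.
\<close>

definition reaches :: "(real ^ 3 \<Rightarrow> real) \<Rightarrow> real ^ 3 \<Rightarrow> real ^ 3 \<Rightarrow> real \<Rightarrow> bool" where
  "reaches P x y L \<longleftrightarrow>
     (\<exists>\<tau> \<eta> (u :: real \<Rightarrow> real ^ 2) C K S. 0 \<le> \<tau> \<and> \<eta> 0 = x \<and> \<eta> \<tau> = y \<and> C-lipschitz_on {0..\<tau>} \<eta> \<and>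
        u \<in> borel_measurable borel \<and> (\<forall>t\<in>{0..\<tau>}. norm (u t) \<le> K) \<and> finite S \<and>
        (\<forall>t\<in>{0<..<\<tau>} - S. (\<eta> has_vector_derivative
           (u t $ 1 *\<^sub>R X1 (\<eta> t) + u t $ 2 *\<^sub>R X2 P (\<eta> t))) (at t)) \<and>
        ((\<lambda>t. norm (u t)) has_integral L) {0..\<tau>})"

lemma reaches_imp_horizontal:
  assumes "reaches P x y L" "x \<noteq> y"
  obtains \<tau> \<eta> u where "horizontal P \<tau> \<eta> u" "\<eta> 0 = x" "\<eta> \<tau> = y" "sR_length \<tau> u = L"
proof -
  from assms(1) obtain \<tau> \<eta> C K S and u :: "real \<Rightarrow> real ^ 2" where "0 \<le> \<tau>" and ends: "\<eta> 0 = x" "\<eta> \<tau> = y"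
    and lip: "C-lipschitz_on {0..\<tau>} \<eta>"
    and u: "u \<in> borel_measurable borel" "\<forall>t\<in>{0..\<tau>}. norm (u t) \<le> K" and "finite S"
    and deriv: "\<forall>t\<in>{0<..<\<tau>} - S. (\<eta> has_vector_derivative
           (u t $ 1 *\<^sub>R X1 (\<eta> t) + u t $ 2 *\<^sub>R X2 P (\<eta> t))) (at t)"
    and len: "((\<lambda>t. norm (u t)) has_integral L) {0..\<tau>}"
    unfolding reaches_def by blast
  have "0 < \<tau>"
    using \<open>0 \<le> \<tau>\<close> ends assms(2) by (cases "\<tau> = 0") auto
  have "AE t in lebesgue. t \<notin> insert 0 (insert \<tau> S)"
    unfolding eventually_ae_filter_negligible
    using \<open>finite S\<close> by (intro exI[of _ "insert 0 (insert \<tau> S)"]) auto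
  then have "AE t in lebesgue. t \<in> {0..\<tau>} \<longrightarrow> (\<eta> has_vector_derivative
           (u t $ 1 *\<^sub>R X1 (\<eta> t) + u t $ 2 *\<^sub>R X2 P (\<eta> t))) (at t within {0..\<tau>})"
  proof eventually_elim
    case (elim t)
    then show ?case
      using deriv by (auto intro: has_vector_derivative_at_within)
  qed
  then have "AE t in lebesgue_on {0..\<tau>}. (\<eta> has_vector_derivative
           (u t $ 1 *\<^sub>R X1 (\<eta> t) + u t $ 2 *\<^sub>R X2 P (\<eta> t))) (at t within {0..\<tau>})"
    by (subst AE_restrict_space_iff) auto
  then have "horizontal P \<tau> \<eta> u"
    using \<open>0 < \<tau>\<close> lip u by (intro horizontal_lipschitzI) auto
  moreover have "sR_length \<tau> u = L"
    using u len by (intro sR_length_eq_has_integral) auto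
  ultimately show thesis
    using that ends by blast
qed

lemma reaches_trans:
  assumes "reaches P x y L" "reaches P y z M"
  shows "reaches P x z (L + M)"
proof -
  from assms(1) obtain \<tau>1 \<eta>1 C1 K1 S1 and u1 :: "real \<Rightarrow> real ^ 2" where "0 \<le> \<tau>1" and ends1: "\<eta>1 0 = x" "\<eta>1 \<tau>1 = y"
    and lip1: "C1-lipschitz_on {0..\<tau>1} \<eta>1"
    and u1: "u1 \<in> borel_measurable borel" "\<forall>t\<in>{0..\<tau>1}. norm (u1 t) \<le> K1" and "finite S1"
    and deriv1: "\<forall>t\<in>{0<..<\<tau>1} - S1. (\<eta>1 has_vector_derivative
           (u1 t $ 1 *\<^sub>R X1 (\<eta>1 t) + u1 t $ 2 *\<^sub>R X2 P (\<eta>1 t))) (at t)"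
    and len1: "((\<lambda>t. norm (u1 t)) has_integral L) {0..\<tau>1}"
    unfolding reaches_def by blast
  from assms(2) obtain \<tau>2 \<eta>2 C2 K2 S2 and u2 :: "real \<Rightarrow> real ^ 2" where "0 \<le> \<tau>2" and ends2: "\<eta>2 0 = y" "\<eta>2 \<tau>2 = z"
    and lip2: "C2-lipschitz_on {0..\<tau>2} \<eta>2"
    and u2: "u2 \<in> borel_measurable borel" "\<forall>t\<in>{0..\<tau>2}. norm (u2 t) \<le> K2" and "finite S2"
    and deriv2: "\<forall>t\<in>{0<..<\<tau>2} - S2. (\<eta>2 has_vector_derivative
           (u2 t $ 1 *\<^sub>R X1 (\<eta>2 t) + u2 t $ 2 *\<^sub>R X2 P (\<eta>2 t))) (at t)"
    and len2: "((\<lambda>t. norm (u2 t)) has_integral M) {0..\<tau>2}"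
    unfolding reaches_def by blast
  define \<eta> where "\<eta> t = (if t \<le> \<tau>1 then \<eta>1 t else \<eta>2 (t - \<tau>1))" for t
  define u where "u t = (if t \<le> \<tau>1 then u1 t else u2 (t - \<tau>1))" for t
  define S where "S = S1 \<union> {\<tau>1} \<union> (\<lambda>t. t + \<tau>1) ` S2"
  have "\<eta> 0 = x" "\<eta> (\<tau>1 + \<tau>2) = z"
    using ends1 ends2 \<open>0 \<le> \<tau>1\<close> \<open>0 \<le> \<tau>2\<close> by (auto simp: \<eta>_def)
  moreover have "(max C1 C2)-lipschitz_on {0..\<tau>1 + \<tau>2} \<eta>"
    unfolding \<eta>_def[abs_def]
  proof (rule lipschitz_on_concat_max[OF lip1])
    show "C2-lipschitz_on {\<tau>1..\<tau>1 + \<tau>2} (\<lambda>t. \<eta>2 (t - \<tau>1))"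
    proof (rule lipschitz_onI)
      fix s t assume "s \<in> {\<tau>1..\<tau>1 + \<tau>2}" "t \<in> {\<tau>1..\<tau>1 + \<tau>2}"
      then show "dist (\<eta>2 (s - \<tau>1)) (\<eta>2 (t - \<tau>1)) \<le> C2 * dist s t"
        using lipschitz_onD[OF lip2, of "s - \<tau>1" "t - \<tau>1"] by (simp add: dist_real_def)
    qed (rule lipschitz_on_nonneg[OF lip2])
  qed (simp add: ends1 ends2)
  moreover have "u \<in> borel_measurable borel"
    unfolding u_def[abs_def] using u1(1) u2(1) by measurable
  moreover have "\<forall>t\<in>{0..\<tau>1 + \<tau>2}. norm (u t) \<le> max K1 K2"
    using u1(2) u2(2) by (auto simp: u_def le_max_iff_disj)
  moreover have "finite S"
    using \<open>finite S1\<close> \<open>finite S2\<close> by (simp add: S_def)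
  moreover have "\<forall>t\<in>{0<..<\<tau>1 + \<tau>2} - S. (\<eta> has_vector_derivative
           (u t $ 1 *\<^sub>R X1 (\<eta> t) + u t $ 2 *\<^sub>R X2 P (\<eta> t))) (at t)"
  proof
    fix t assume t: "t \<in> {0<..<\<tau>1 + \<tau>2} - S"
    show "(\<eta> has_vector_derivative (u t $ 1 *\<^sub>R X1 (\<eta> t) + u t $ 2 *\<^sub>R X2 P (\<eta> t))) (at t)"
    proof (cases "t < \<tau>1")
      case True
      then have "(\<eta>1 has_vector_derivative (u1 t $ 1 *\<^sub>R X1 (\<eta>1 t) + u1 t $ 2 *\<^sub>R X2 P (\<eta>1 t))) (at t)"
        using deriv1 t by (auto simp: S_def)
      then have "(\<eta> has_vector_derivative (u1 t $ 1 *\<^sub>R X1 (\<eta>1 t) + u1 t $ 2 *\<^sub>R X2 P (\<eta>1 t))) (at t)"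
        by (rule has_vector_derivative_transform_within_open[of _ _ _ "{..<\<tau>1}"]) (use True in \<open>auto simp: \<eta>_def\<close>)
      then show ?thesis
        using True by (simp add: \<eta>_def u_def)
    next
      case False
      then have "\<tau>1 < t"
        using t by (auto simp: S_def)
      moreover have "t - \<tau>1 \<notin> S2"
        using t by (force simp: S_def)
      ultimately have "(\<eta>2 has_vector_derivative (u2 (t - \<tau>1) $ 1 *\<^sub>R X1 (\<eta>2 (t - \<tau>1)) +
          u2 (t - \<tau>1) $ 2 *\<^sub>R X2 P (\<eta>2 (t - \<tau>1)))) (at (t - \<tau>1))"
        using deriv2 t by auto
      moreover have "((\<lambda>t. t - \<tau>1) has_vector_derivative 1) (at t)"
        by (auto intro!: derivative_eq_intros)
      ultimately have "((\<lambda>t. \<eta>2 (t - \<tau>1)) has_vector_derivative (u2 (t - \<tau>1) $ 1 *\<^sub>R X1 (\<eta>2 (t - \<tau>1)) +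
          u2 (t - \<tau>1) $ 2 *\<^sub>R X2 P (\<eta>2 (t - \<tau>1)))) (at t)"
        using vector_diff_chain_at[of "\<lambda>t. t - \<tau>1" 1 t \<eta>2] by (simp add: o_def)
      then have "(\<eta> has_vector_derivative (u2 (t - \<tau>1) $ 1 *\<^sub>R X1 (\<eta>2 (t - \<tau>1)) +
          u2 (t - \<tau>1) $ 2 *\<^sub>R X2 P (\<eta>2 (t - \<tau>1)))) (at t)"
        by (rule has_vector_derivative_transform_within_open[of _ _ _ "{\<tau>1<..}"])
          (use \<open>\<tau>1 < t\<close> in \<open>auto simp: \<eta>_def\<close>)
      then show ?thesis
        using \<open>\<tau>1 < t\<close> by (simp add: \<eta>_def u_def)
    qed
  qed
  moreover have "((\<lambda>t. norm (u t)) has_integral L + M) {0..\<tau>1 + \<tau>2}"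
  proof (rule has_integral_combine)
    show "((\<lambda>t. norm (u t)) has_integral L) {0..\<tau>1}"
      by (rule has_integral_eq[OF _ len1]) (simp add: u_def)
    have "((\<lambda>t. norm (u2 (t - \<tau>1))) has_integral M) {\<tau>1..\<tau>1 + \<tau>2}"
      using has_integral_shift_real_ivl[OF len2, of "- \<tau>1"] by (simp add: add.commute)
    then show "((\<lambda>t. norm (u t)) has_integral M) {\<tau>1..\<tau>1 + \<tau>2}"
      by (rule has_integral_spike_finite[of "{\<tau>1}", rotated 2]) (auto simp: u_def)
  qed (use \<open>0 \<le> \<tau>1\<close> \<open>0 \<le> \<tau>2\<close> in auto)
  moreover have "0 \<le> \<tau>1 + \<tau>2"
    using \<open>0 \<le> \<tau>1\<close> \<open>0 \<le> \<tau>2\<close> by simp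
  ultimately show ?thesis
    unfolding reaches_def by blast
qed

text \<open>
  Compactness of the parameter interval provides both the Lipschitz constant and the bound on the
  control.
\<close>

lemma reaches_C1:
  assumes "0 \<le> \<tau>" and cont_P: "continuous_on UNIV P"
    and cont: "continuous_on {0..\<tau>} f" "continuous_on {0..\<tau>} g"
    and deriv: "\<And>t. t \<in> {0..\<tau>} \<Longrightarrow>
      (\<eta> has_vector_derivative vector [f t, g t, g t * (P (\<eta> t))\<^sup>2]) (at t)"
  shows "reaches P (\<eta> 0) (\<eta> \<tau>) (integral {0..\<tau>} (\<lambda>t. sqrt ((f t)\<^sup>2 + (g t)\<^sup>2)))"
proof -
  define w :: "real \<Rightarrow> real ^ 2" where "w t = vector [f t, g t]" for t
  define u where "u t = indicator {0..\<tau>} t *\<^sub>R w t" for t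
  have u_eq: "u t = w t" if "t \<in> {0..\<tau>}" for t
    using that by (simp add: u_def)
  have norm_w: "norm (w t) = sqrt ((f t)\<^sup>2 + (g t)\<^sup>2)" for t
    by (simp add: norm_vec_2 w_def)
  have "w = (\<lambda>t. f t *\<^sub>R axis 1 1 + g t *\<^sub>R axis 2 1)"
    by (simp add: w_def fun_eq_iff vec_eq_iff forall_2 axis_def)
  then have cont_w: "continuous_on {0..\<tau>} w"
    using cont by (auto intro!: continuous_intros)
  then have meas: "u \<in> borel_measurable borel"
    unfolding u_def[abs_def] by (intro borel_measurable_continuous_on_indicator) auto
  have "bounded (w ` {0..\<tau>})"
    by (intro compact_imp_bounded compact_continuous_image) (simp_all add: cont_w)
  then obtain K where K: "\<And>t. t \<in> {0..\<tau>} \<Longrightarrow> norm (w t) \<le> K"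
    unfolding bounded_iff by blast
  have "continuous_on {0..\<tau>} \<eta>"
    using deriv by (intro continuous_at_imp_continuous_on ballI) (blast dest: has_vector_derivative_continuous)
  then have "continuous_on {0..\<tau>} (\<lambda>t. vector [f t, g t, g t * (P (\<eta> t))\<^sup>2] :: real ^ 3)"
      (is "continuous_on _ ?v")
    unfolding vector_3_eq using cont
    by (auto intro!: continuous_intros continuous_on_compose2[OF cont_P])
  then have "bounded (?v ` {0..\<tau>})"
    by (intro compact_imp_bounded compact_continuous_image) simp_all
  then obtain C where C: "\<And>t. t \<in> {0..\<tau>} \<Longrightarrow> norm (?v t) \<le> C"
    unfolding bounded_iff by blast
  have "C-lipschitz_on {0..\<tau>} \<eta>"
  proof (rule vector_derivative_bounded_imp_lipschitz)
    show "0 \<le> C"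
      using C[of 0] \<open>0 \<le> \<tau>\<close> by (auto intro: order_trans[OF norm_ge_zero])
  qed (use deriv C in \<open>auto intro: has_vector_derivative_at_within\<close>)
  moreover have "((\<lambda>t. norm (u t)) has_integral integral {0..\<tau>} (\<lambda>t. sqrt ((f t)\<^sup>2 + (g t)\<^sup>2))) {0..\<tau>}"
  proof (rule has_integral_eq)
    show "((\<lambda>t. norm (w t)) has_integral integral {0..\<tau>} (\<lambda>t. sqrt ((f t)\<^sup>2 + (g t)\<^sup>2))) {0..\<tau>}"
      unfolding norm_w using cont
      by (intro integrable_integral integrable_continuous_real continuous_intros)
  qed (simp add: u_eq)
  moreover have "\<forall>t\<in>{0<..<\<tau>} - {}. (\<eta> has_vector_derivative
           (u t $ 1 *\<^sub>R X1 (\<eta> t) + u t $ 2 *\<^sub>R X2 P (\<eta> t))) (at t)"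
    using deriv by (simp add: frame_combination u_eq w_def)
  moreover have "\<forall>t\<in>{0..\<tau>}. norm (u t) \<le> K"
    using K by (simp add: u_eq)
  ultimately show ?thesis
    unfolding reaches_def using \<open>0 \<le> \<tau>\<close> meas finite.emptyI by blast
qed

section \<open>The pieces of the competitor\<close>

lemma has_real_derivative_power_div:
  "((\<lambda>t. t ^ Suc n / real (Suc n)) has_real_derivative t ^ n) (at t within A)"
proof -
  have "((\<lambda>t. t ^ Suc n / real (Suc n)) has_real_derivative real (Suc n) * t ^ n / real (Suc n)) (at t within A)"
    using DERIV_pow[of "Suc n" t A] by (intro DERIV_cdivide) simp
  then show ?thesis
    by simp
qed

text \<open>
  The polynomial primitive of \<open>s \<mapsto> (\<alpha> - s ^ b)\<^sup>2\<close> vanishing at \<open>0\<close>: along a line \<open>x\<^sub>1 = x\<close> parallel to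
  the second axis, \<open>x\<^sub>3\<close> changes by its increments with \<open>\<alpha> = x ^ a\<close>.
\<close>

definition square_primitive :: "nat \<Rightarrow> real \<Rightarrow> real \<Rightarrow> real" where
  "square_primitive b \<alpha> s = \<alpha>\<^sup>2 * s - 2 * \<alpha> * (s ^ Suc b / Suc b) + s ^ Suc (2 * b) / Suc (2 * b)"

lemma square_primitive_derivative:
  "(square_primitive b \<alpha> has_real_derivative (\<alpha> - s ^ b)\<^sup>2) (at s)"
proof -
  have "((\<lambda>s. \<alpha>\<^sup>2 * s - 2 * \<alpha> * (s ^ Suc b / Suc b) + s ^ Suc (2 * b) / Suc (2 * b))
      has_real_derivative \<alpha>\<^sup>2 * 1 - 2 * \<alpha> * s ^ b + s ^ (2 * b)) (at s)"
    by (intro DERIV_add DERIV_diff DERIV_cmult has_real_derivative_power_div DERIV_ident)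
  moreover have "\<alpha>\<^sup>2 * 1 - 2 * \<alpha> * s ^ b + s ^ (2 * b) = (\<alpha> - s ^ b)\<^sup>2"
    by (simp add: power2_diff power_mult[symmetric] mult.commute)
  ultimately show ?thesis
    by (simp add: square_primitive_def[abs_def])
qed

lemma reaches_along_X1:
  assumes "continuous_on UNIV P"
  shows "reaches P (vector [x, y, z]) (vector [x + h, y, z]) \<bar>h\<bar>"
proof -
  have "((\<lambda>t. vector [x + h * t, y, z] :: real ^ 3) has_vector_derivative
      vector [h, 0, 0 * (P (vector [x + h * t, y, z]))\<^sup>2]) (at t)" for t
    by (intro has_vector_derivative_vector_3) (auto intro!: derivative_eq_intros)
  from reaches_C1[OF _ assms _ _ this, of 1] show ?thesis
    by simp
qed

lemma reaches_along_X2: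
  "reaches (P_poly a b) (vector [x, y, z])
     (vector [x, y + h, z + (square_primitive b (x ^ a) (y + h) - square_primitive b (x ^ a) y)]) \<bar>h\<bar>"
proof -
  let ?w = "\<lambda>t. z + (square_primitive b (x ^ a) (y + h * t) - square_primitive b (x ^ a) y)"
  have "((\<lambda>t. vector [x, y + h * t, ?w t] :: real ^ 3) has_vector_derivative
      vector [0, h, h * (P_poly a b (vector [x, y + h * t, ?w t]))\<^sup>2]) (at t)" for t
  proof (intro has_vector_derivative_vector_3)
    have "((\<lambda>t. square_primitive b (x ^ a) (y + h * t)) has_real_derivative (x ^ a - (y + h * t) ^ b)\<^sup>2 * h) (at t)"
      by (rule DERIV_chain2[OF square_primitive_derivative]) (auto intro!: derivative_eq_intros)
    then show "(?w has_real_derivative h * (P_poly a b (vector [x, y + h * t, ?w t]))\<^sup>2) (at t)"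
      by (auto intro!: derivative_eq_intros)
  qed (auto intro!: derivative_eq_intros)
  from reaches_C1[OF _ P_poly_continuous _ _ this, of 1] show ?thesis
    by simp
qed

text \<open>
  For \<open>m = s powr (q - 1)\<close> this is the chord from the origin to the point of the curve at time \<open>s\<close>. On
  it \<open>0 \<le> P \<le> s ^ b\<close>, so its lift overshoots in the third coordinate by at most \<open>s \<cdot> (s ^ b)\<^sup>2\<close>.
\<close>

lemma reaches_along_segment:
  assumes "0 < s" "a \<le> b" "m ^ a = s ^ (b - a)"
  obtains E where "0 \<le> E" "E \<le> s ^ (2 * b + 1)"
    and "reaches (P_poly a b) (vector [0, 0, 0]) (vector [m * s, s, E]) (s * sqrt (1 + m\<^sup>2))"
proof -
  define G where "G t = (m ^ a)\<^sup>2 * (t ^ Suc (2 * a) / Suc (2 * a))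
      - 2 * m ^ a * (t ^ Suc (a + b) / Suc (a + b)) + t ^ Suc (2 * b) / Suc (2 * b)" for t
  have G': "(G has_real_derivative ((m * t) ^ a - t ^ b)\<^sup>2) (at t)" for t
  proof -
    have "(G has_real_derivative (m ^ a)\<^sup>2 * t ^ (2 * a) - 2 * m ^ a * t ^ (a + b) + t ^ (2 * b)) (at t)"
      unfolding G_def[abs_def]
      by (intro DERIV_add DERIV_diff DERIV_cmult has_real_derivative_power_div)
    moreover have "((m * t) ^ a - t ^ b)\<^sup>2 = (m ^ a)\<^sup>2 * t ^ (2 * a) - 2 * m ^ a * t ^ (a + b) + t ^ (2 * b)"
      by (simp add: power2_diff power_mult_distrib power_add power_mult[symmetric] mult.commute mult.left_commute)
    ultimately show ?thesis
      by simp
  qed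
  have "G 0 = 0"
    by (simp add: G_def)
  obtain z where z: "0 < z" "z < s" "G s - G 0 = (s - 0) * ((m * z) ^ a - z ^ b)\<^sup>2"
    using MVT2[OF \<open>0 < s\<close> G'] by blast
  have "z ^ b = z ^ (b - a) * z ^ a"
    using assms(2) by (simp add: power_add[symmetric])
  also have "\<dots> \<le> s ^ (b - a) * z ^ a"
    using z by (intro mult_right_mono power_mono) auto
  also have "\<dots> = (m * z) ^ a"
    by (simp add: power_mult_distrib assms(3))
  finally have le: "z ^ b \<le> (m * z) ^ a" .
  have "(m * z) ^ a = s ^ (b - a) * z ^ a"
    by (simp add: power_mult_distrib assms(3))
  also have "\<dots> \<le> s ^ (b - a) * s ^ a"
    using z by (intro mult_left_mono power_mono) auto
  also have "\<dots> = s ^ b"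
    using assms(2) by (simp add: power_add[symmetric])
  finally have "(m * z) ^ a \<le> s ^ b" .
  then have "((m * z) ^ a - z ^ b)\<^sup>2 \<le> (s ^ b)\<^sup>2"
    using le z by (intro power_mono) (auto intro: order_trans[OF _ \<open>(m * z) ^ a \<le> s ^ b\<close>])
  then have "s * ((m * z) ^ a - z ^ b)\<^sup>2 \<le> s * (s ^ b)\<^sup>2"
    using \<open>0 < s\<close> by (intro mult_left_mono) auto
  then have "G s \<le> s ^ (2 * b + 1)"
    using z(3) \<open>G 0 = 0\<close> by (simp add: power_mult[symmetric] mult.commute)
  moreover have "0 \<le> G s"
    using z \<open>G 0 = 0\<close> \<open>0 < s\<close> by simp
  moreover have "reaches (P_poly a b) (vector [0, 0, 0]) (vector [m * s, s, G s]) (s * sqrt (1 + m\<^sup>2))"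
  proof -
    have "((\<lambda>t. vector [m * t, t, G t] :: real ^ 3) has_vector_derivative
        vector [m, 1, 1 * (P_poly a b (vector [m * t, t, G t]))\<^sup>2]) (at t)" for t
      using G' by (intro has_vector_derivative_vector_3) (auto intro!: derivative_eq_intros)
    from reaches_C1[OF _ P_poly_continuous _ _ this, of s] show ?thesis
      using \<open>0 < s\<close> \<open>G 0 = 0\<close> by (simp add: add.commute)
  qed
  ultimately show thesis
    using that by blast
qed

text \<open>
  \<open>P\<close> vanishes along the power curve, so the curve lifts to every height \<open>E\<close> without changing it.
\<close>

lemma reaches_along_power_curve:
  assumes "0 < s" "s \<le> \<epsilon>" and cont: "continuous_on UNIV P"
    and zero: "\<And>t. 0 \<le> t \<Longrightarrow> P (vector [t powr q, t, E]) = 0"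
  shows "reaches P (vector [s powr q, s, E]) (vector [\<epsilon> powr q, \<epsilon>, E])
      (integral {s..\<epsilon>} (\<lambda>t. norm (power_control q t)))"
proof -
  have "((\<lambda>t. vector [(t + s) powr q, t + s, E] :: real ^ 3) has_vector_derivative
      vector [q * (t + s) powr (q - 1), 1, 1 * (P (vector [(t + s) powr q, t + s, E]))\<^sup>2]) (at t)"
    if "t \<in> {0..\<epsilon> - s}" for t
    using that \<open>0 < s\<close> zero[of "t + s"]
    by (intro has_vector_derivative_vector_3) (auto intro!: derivative_eq_intros)
  note deriv = this
  have "continuous_on {0..\<epsilon> - s} (\<lambda>t. q * (t + s) powr (q - 1))"
    using \<open>0 < s\<close> by (intro continuous_on_mult continuous_on_const continuous_on_powr continuous_on_add continuous_on_id) auto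
  from reaches_C1[of "\<epsilon> - s", OF _ cont this _ deriv]
  have "reaches P (vector [s powr q, s, E]) (vector [\<epsilon> powr q, \<epsilon>, E])
      (integral {0..\<epsilon> - s} (\<lambda>t. sqrt ((q * (t + s) powr (q - 1))\<^sup>2 + 1\<^sup>2)))"
    using assms(1,2) by (auto intro!: continuous_intros)
  moreover have "integral {0..\<epsilon> - s} (\<lambda>t. norm (power_control q (t + s))) =
      integral {s..\<epsilon>} (\<lambda>t. norm (power_control q t))"
    using integral_shift_Icc_real[of 0 "\<epsilon> - s" "\<lambda>t. norm (power_control q t)" s]
    by (simp add: o_def add.commute)
  ultimately show ?thesis
    by (simp add: norm_power_control add.commute)
qed

text \<open>
  Start at a point \<open>(A, B)\<close> of the zero curve, move right by \<open>r\<close>, down by \<open>r\<close>, left and up again.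
  Going down happens at \<open>x\<^sub>1 = A + r\<close>, where \<open>P\<close> is larger by at least \<open>A ^ (a - 1) r\<close> than at
  \<open>x\<^sub>1 = A\<close>, where the loop goes up. The net effect is to lower \<open>x\<^sub>3\<close> by an amount \<open>D r\<close> of at
  least \<open>(A ^ (a - 1))\<^sup>2 r ^ 3\<close>. Since \<open>D\<close> is continuous with \<open>D 0 = 0\<close>, every \<open>E\<close> below that bound for
  \<open>r0\<close> is removed exactly by some \<open>r \<le> r0\<close>.
\<close>

lemma reaches_by_square_loop:
  assumes "0 < a" "0 < A" "A ^ a = B ^ b" "0 \<le> r0" "r0 \<le> B"
    and E: "0 \<le> E" "E \<le> (A ^ (a - 1))\<^sup>2 * r0 ^ 3"
  obtains r where "0 \<le> r" "r \<le> r0"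
    and "reaches (P_poly a b) (vector [A, B, E]) (vector [A, B, 0]) (4 * r)"
proof -
  let ?W = "square_primitive b"
  define D where "D r = (?W ((A + r) ^ a) B - ?W ((A + r) ^ a) (B - r)) - (?W (A ^ a) B - ?W (A ^ a) (B - r))" for r
  have "E \<le> D r0"
  proof (cases "r0 = 0")
    case True
    then show ?thesis
      using E by (simp add: D_def)
  next
    case False
    then have "0 < r0"
      using assms(4) by simp
    let ?h = "\<lambda>s. ?W ((A + r0) ^ a) s - ?W (A ^ a) s"
    have h': "\<And>s. (?h has_real_derivative ((A + r0) ^ a - s ^ b)\<^sup>2 - (A ^ a - s ^ b)\<^sup>2) (at s)"
      by (intro DERIV_diff square_primitive_derivative)
    obtain z where z: "B - r0 < z" "z < B"
      and h: "?h B - ?h (B - r0) = (B - (B - r0)) * (((A + r0) ^ a - z ^ b)\<^sup>2 - (A ^ a - z ^ b)\<^sup>2)"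
      using MVT2[of "B - r0" B, OF _ h'] \<open>0 < r0\<close> by auto
    have "z ^ b \<le> A ^ a"
      unfolding assms(3) using z assms(5) by (intro power_mono) auto
    have "A ^ (a - 1) * r0 + A ^ a = A ^ (a - 1) * (A + r0)"
      using \<open>0 < a\<close> by (cases a) (auto simp: algebra_simps)
    also have "\<dots> \<le> (A + r0) ^ (a - 1) * (A + r0)"
      using assms(2,4) by (intro mult_right_mono power_mono) auto
    also have "\<dots> = (A + r0) ^ a"
      using \<open>0 < a\<close> by (cases a) auto
    finally have gap: "A ^ (a - 1) * r0 \<le> (A + r0) ^ a - A ^ a"
      by simp
    then have "(A ^ (a - 1) * r0)\<^sup>2 \<le> ((A + r0) ^ a - A ^ a)\<^sup>2"
      using assms(2,4) by (intro power_mono) auto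
    also have "\<dots> \<le> ((A + r0) ^ a - A ^ a) * ((A + r0) ^ a - A ^ a + 2 * (A ^ a - z ^ b))"
      unfolding power2_eq_square using assms(2,4) \<open>z ^ b \<le> A ^ a\<close>
      by (intro mult_left_mono) (auto intro: power_mono)
    also have "\<dots> = ((A + r0) ^ a - z ^ b)\<^sup>2 - (A ^ a - z ^ b)\<^sup>2"
      by (simp add: power2_eq_square algebra_simps)
    finally have "r0 * (A ^ (a - 1) * r0)\<^sup>2 \<le> r0 * (((A + r0) ^ a - z ^ b)\<^sup>2 - (A ^ a - z ^ b)\<^sup>2)"
      using assms(4) by (rule mult_left_mono)
    also have "\<dots> = D r0"
      using h by (simp add: D_def)
    finally show ?thesis
      using E by (simp add: power2_eq_square power3_eq_cube algebra_simps)
  qed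
  moreover have "D 0 \<le> E"
    using E by (simp add: D_def)
  moreover have "continuous_on {0..r0} D"
    unfolding D_def[abs_def] square_primitive_def by (intro continuous_intros) auto
  ultimately obtain r where r: "0 \<le> r" "r \<le> r0" "D r = E"
    using IVT'[of D 0 E r0] assms(4) by blast
  let ?w = "?W ((A + r) ^ a) (B + - r) - ?W ((A + r) ^ a) B"
  let ?v = "?W ((A + r + - r) ^ a) (B + - r + r) - ?W ((A + r + - r) ^ a) (B + - r)"
  have "reaches (P_poly a b) (vector [A, B, E])
      (vector [A + r + - r, B + - r + r, E + ?w + ?v]) (\<bar>r\<bar> + \<bar>- r\<bar> + \<bar>- r\<bar> + \<bar>r\<bar>)"
    by (intro reaches_trans[OF reaches_trans[OF reaches_trans[OF
        reaches_along_X1[OF P_poly_continuous] reaches_along_X2] reaches_along_X1[OF P_poly_continuous]]]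
        reaches_along_X2)
  moreover have "E + ?w + ?v = 0"
    using r(3) by (simp add: D_def)
  ultimately have "reaches (P_poly a b) (vector [A, B, E]) (vector [A, B, 0]) (4 * r)"
    using r(1) by simp
  then show thesis
    using that r by blast
qed

section \<open>The length gained by the chord\<close>

lemma power_length_integrable:
  assumes "1 < q" "0 \<le> a"
  shows "(\<lambda>t. norm (power_control q t)) integrable_on {a..b}"
proof -
  have "continuous_on {0..} (\<lambda>t. t powr (q - 1))"
    using assms(1) by (intro continuous_on_powr') (auto intro!: continuous_intros)
  then have "continuous_on {a..b} (\<lambda>t. t powr (q - 1))"
    by (rule continuous_on_subset) (use assms(2) in auto)
  then show ?thesis
    unfolding norm_power_control
    by (intro integrable_continuous_real continuous_on_real_sqrt continuous_on_add continuous_on_power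
        continuous_on_mult continuous_on_const)
qed

text \<open>
  The quadratic Taylor polynomial is an upper bound; lowering its coefficient from \<open>1/2\<close> to
  \<open>c/2\<close> turns it into a lower bound near \<open>0\<close>.
\<close>

lemma sqrt_one_plus_square_ge:
  fixes x c :: real
  assumes "0 \<le> c" "c\<^sup>2 * x\<^sup>2 \<le> 4 * (1 - c)"
  shows "1 + c * x\<^sup>2 / 2 \<le> sqrt (1 + x\<^sup>2)"
proof (rule real_le_rsqrt)
  have "x\<^sup>2 * (c\<^sup>2 * x\<^sup>2) \<le> x\<^sup>2 * (4 * (1 - c))"
    using assms(2) by (intro mult_left_mono) auto
  then show "(1 + c * x\<^sup>2 / 2)\<^sup>2 \<le> 1 + x\<^sup>2"
    by (simp add: power2_eq_square field_simps)
qed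

lemma powr_tendsto_zero_at_right:
  fixes r :: real
  assumes "0 < r"
  shows "((\<lambda>s. s powr r) \<longlongrightarrow> 0) (at_right 0)"
proof (rule tendsto_zero_powrI)
  show "\<forall>\<^sub>F s in at_right 0. 0 \<le> (s :: real)"
    using eventually_at_right_less[of "0 :: real"] by (rule eventually_mono) simp
qed (use assms in \<open>auto intro!: tendsto_intros\<close>)

text \<open>
  To leading order the curve and its chord exceed \<open>s\<close> by \<open>q\<^sup>2 / (2 (2 q - 1)) s powr (2 q - 1)\<close> and
  \<open>1/2 s powr (2 q - 1)\<close>. The difference is positive because \<open>q\<^sup>2 - (2 q - 1) = (q - 1)\<^sup>2 > 0\<close>.
\<close>

lemma chord_shorter_than_power_curve:
  assumes "1 < q"
  obtains \<kappa> where "0 < \<kappa>"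
    and "\<forall>\<^sub>F s in at_right 0. s * sqrt (1 + (s powr (q - 1))\<^sup>2) + \<kappa> * s powr (2 * q - 1)
      \<le> integral {0..s} (\<lambda>t. norm (power_control q t))"
proof -
  \<comment> \<open>The midpoint between \<open>1\<close>, where the lower bound for the square root fails, and
    \<open>(2 q - 1) / q\<^sup>2\<close>, where the gain is zero.\<close>
  define c where "c = (1 + (2 * q - 1) / q\<^sup>2) / 2"
  define p where "p = q\<^sup>2 / (2 * q - 1)"
  define \<kappa> where "\<kappa> = (c * p - 1) / 2"
  have "0 < (q - 1)\<^sup>2"
    using assms by simp
  then have lt: "2 * q - 1 < q\<^sup>2"
    by (simp add: power2_eq_square algebra_simps)
  then have "0 \<le> c" "c < 1"
    using assms by (auto simp: c_def field_simps)
  have "1 < p"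
    using lt assms by (simp add: p_def field_simps)
  then have "1 < (p + 1) / 2"
    by simp
  also have "(p + 1) / 2 = c * p"
    using assms by (simp add: c_def p_def field_simps)
  finally have "0 < \<kappa>"
    by (simp add: \<kappa>_def)
  have "((\<lambda>s. c\<^sup>2 * (q * s powr (q - 1))\<^sup>2) \<longlongrightarrow> c\<^sup>2 * (q * 0)\<^sup>2) (at_right 0)"
    by (intro tendsto_intros powr_tendsto_zero_at_right) (use assms in simp)
  then have "\<forall>\<^sub>F s in at_right 0. c\<^sup>2 * (q * s powr (q - 1))\<^sup>2 < 4 * (1 - c)"
    using \<open>c < 1\<close> by (intro order_tendstoD) auto
  moreover have "\<forall>\<^sub>F s in at_right 0. 0 < (s :: real)"
    by (rule eventually_at_right_less)
  ultimately have "\<forall>\<^sub>F s in at_right 0. s * sqrt (1 + (s powr (q - 1))\<^sup>2) + \<kappa> * s powr (2 * q - 1)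
      \<le> integral {0..s} (\<lambda>t. norm (power_control q t))"
  proof eventually_elim
    case (elim s)
    have sq: "(t powr (q - 1))\<^sup>2 = t powr (2 * q - 2)" if "0 \<le> t" for t :: real
      using that by (cases "t = 0") (auto simp: powr_realpow[symmetric] powr_powr algebra_simps)
    let ?G = "\<lambda>t. t + c * p / 2 * t powr (2 * q - 1)"
    have "((\<lambda>t. 1 + c * (q * t powr (q - 1))\<^sup>2 / 2) has_integral ?G s - ?G 0) {0..s}"
    proof (rule fundamental_theorem_of_calculus)
      fix t assume t: "t \<in> {0..s}"
      have "((\<lambda>t. t powr (2 * q - 1)) has_real_derivative (2 * q - 1) * t powr (2 * q - 1 - 1)) (at t within {0..s})"
        using assms t by (intro has_real_derivative_powr_within) auto
      then have "(?G has_real_derivative 1 + c * p / 2 * ((2 * q - 1) * t powr (2 * q - 1 - 1)))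
          (at t within {0..s})"
        by (intro DERIV_add DERIV_cmult DERIV_ident)
      moreover have "1 + c * p / 2 * ((2 * q - 1) * t powr (2 * q - 1 - 1)) =
          1 + c * (q * t powr (q - 1))\<^sup>2 / 2"
      proof -
        have "c * p / 2 * ((2 * q - 1) * t powr (2 * q - 1 - 1)) = c * (p * (2 * q - 1)) * t powr (2 * q - 2) / 2"
          by simp
        also have "p * (2 * q - 1) = q\<^sup>2"
          using assms by (simp add: p_def)
        finally show ?thesis
          using t by (simp add: power_mult_distrib sq)
      qed
      ultimately show "(?G has_vector_derivative 1 + c * (q * t powr (q - 1))\<^sup>2 / 2) (at t within {0..s})"
        unfolding has_real_derivative_iff_has_vector_derivative by (simp only:)
    qed (use elim in auto)
    moreover have "((\<lambda>t. norm (power_control q t)) has_integral integral {0..s} (\<lambda>t. norm (power_control q t))) {0..s}"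
      using power_length_integrable[OF assms, of 0 s] by (simp add: integrable_integral)
    ultimately have "?G s - ?G 0 \<le> integral {0..s} (\<lambda>t. norm (power_control q t))"
    proof (rule has_integral_le)
      fix t assume t: "t \<in> {0..s}"
      have "c\<^sup>2 * (q * t powr (q - 1))\<^sup>2 \<le> c\<^sup>2 * (q * s powr (q - 1))\<^sup>2"
        using t assms by (intro mult_left_mono power_mono powr_mono2) auto
      then show "1 + c * (q * t powr (q - 1))\<^sup>2 / 2 \<le> norm (power_control q t)"
        unfolding norm_power_control using elim \<open>0 \<le> c\<close> by (intro sqrt_one_plus_square_ge) auto
    qed
    moreover have "s * sqrt (1 + (s powr (q - 1))\<^sup>2) \<le> s + s powr (2 * q - 1) / 2"
    proof -
      have "sqrt (1 + (s powr (q - 1))\<^sup>2) \<le> 1 + (s powr (q - 1))\<^sup>2 / 2"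
        by (rule real_le_lsqrt) (auto simp: power2_eq_square algebra_simps)
      then have "s * sqrt (1 + (s powr (q - 1))\<^sup>2) \<le> s * (1 + s powr (2 * q - 2) / 2)"
        using elim by (intro mult_left_mono) (auto simp: sq)
      also have "\<dots> = s + s powr (2 * q - 2 + 1) / 2"
        unfolding powr_add using elim by (simp add: algebra_simps)
      finally show ?thesis
        by simp
    qed
    moreover have "?G s - ?G 0 = s + s powr (2 * q - 1) / 2 + \<kappa> * s powr (2 * q - 1)"
      using assms by (simp add: \<kappa>_def field_simps)
    ultimately show ?case
      by linarith
  qed
  then show thesis
    using that \<open>0 < \<kappa>\<close> by blast
qed

section \<open>Failure of minimality\<close>

lemma sR_length_cong:
  assumes "horizontal P \<tau> \<eta> u" "horizontal P \<tau> \<eta> v"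
  shows "sR_length \<tau> u = sR_length \<tau> v"
proof -
  have "u \<in> borel_measurable (lebesgue_on {0..\<tau>})" "v \<in> borel_measurable (lebesgue_on {0..\<tau>})"
    using assms by (auto simp: horizontal_def L2_control_def)
  moreover have "AE t in lebesgue_on {0..\<tau>}. norm (u t) = norm (v t)"
    using horizontal_control_unique[OF assms] by eventually_elim simp
  ultimately show ?thesis
    unfolding sR_length_def norm_vec_2[symmetric] by (intro integral_cong_AE) auto
qed

text \<open>
  The chord up to time \<open>s\<close> saves a length of order \<open>s powr (2 q - 1)\<close> and creates an error
  \<open>E \<le> s ^ (2 b + 1)\<close> in the third coordinate. A loop at the endpoint removes the error at a cost of order
  \<open>E powr (1/3)\<close>, that is \<open>s powr ((2 b + 1) / 3)\<close>. By the hypothesis on the exponents the cost is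
  negligible against the gain as \<open>s\<close> tends to \<open>0\<close>.
\<close>

lemma not_length_minimizing_power_curve:
  assumes "0 < a" "a < b" and q: "q = real b / real a" and "0 < \<epsilon>"
    and exponents: "2 * q - 1 < (2 * real b + 1) / 3"
  shows "\<not> length_minimizing (P_poly a b) \<epsilon> (power_curve q)"
proof
  assume min: "length_minimizing (P_poly a b) \<epsilon> (power_curve q)"
  have "1 < q"
    using assms(1,2) q by simp
  let ?len = "\<lambda>t. norm (power_control q t)"
  let ?\<mu> = "(2 * real b + 1) / 3"
  define A where "A = \<epsilon> powr q"
  have "0 < A"
    using \<open>0 < \<epsilon>\<close> by (simp add: A_def)
  have on_curve: "(t powr q) ^ a = t ^ b" if "0 \<le> t" for t
    using P_poly_power_curve[OF that assms(1), of b] assms(1,2) by (simp add: q P_poly_def)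
  \<comment> \<open>Chosen so that a loop of side \<open>K * s powr ((2 b + 1) / 3)\<close> removes at least \<open>s ^ (2 b + 1)\<close>.\<close>
  define K where "K = root 3 (1 / (A ^ (a - 1))\<^sup>2)"
  have "0 < K" "K ^ 3 = 1 / (A ^ (a - 1))\<^sup>2"
    using \<open>0 < A\<close> by (simp_all add: K_def real_root_gt_zero)
  obtain \<kappa> where "0 < \<kappa>" and gain: "\<forall>\<^sub>F s in at_right 0.
      s * sqrt (1 + (s powr (q - 1))\<^sup>2) + \<kappa> * s powr (2 * q - 1) \<le> integral {0..s} ?len"
    by (rule chord_shorter_than_power_curve[OF \<open>1 < q\<close>])
  have pos: "\<forall>\<^sub>F s in at_right 0. 0 < (s :: real)"
    by (rule eventually_at_right_less)
  have "((\<lambda>s. K * s powr ?\<mu>) \<longlongrightarrow> K * 0) (at_right 0)"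
    by (intro tendsto_intros powr_tendsto_zero_at_right) simp
  then have small: "\<forall>\<^sub>F s in at_right 0. K * s powr ?\<mu> < \<epsilon>"
    using \<open>0 < \<epsilon>\<close> by (intro order_tendstoD) auto
  have "((\<lambda>s. 4 * K * s powr (?\<mu> - (2 * q - 1))) \<longlongrightarrow> 4 * K * 0) (at_right 0)"
    using exponents by (intro tendsto_intros powr_tendsto_zero_at_right) simp
  then have cost: "\<forall>\<^sub>F s in at_right 0. 4 * K * s powr (?\<mu> - (2 * q - 1)) < \<kappa>"
    using \<open>0 < \<kappa>\<close> by (intro order_tendstoD) auto
  have "\<forall>\<^sub>F s in at_right 0. s < \<epsilon>"
    using \<open>0 < \<epsilon>\<close> by (simp add: eventually_at_right_field) (use dense in blast)
  with gain pos small cost have "\<forall>\<^sub>F s in at_right 0. 0 < s \<and> s < \<epsilon> \<and> K * s powr ?\<mu> < \<epsilon> \<and>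
      4 * K * s powr (?\<mu> - (2 * q - 1)) < \<kappa> \<and>
      s * sqrt (1 + (s powr (q - 1))\<^sup>2) + \<kappa> * s powr (2 * q - 1) \<le> integral {0..s} ?len"
    by eventually_elim simp
  then obtain s where s: "0 < s" "s < \<epsilon>" and r0: "K * s powr ?\<mu> < \<epsilon>"
    and s_cost: "4 * K * s powr (?\<mu> - (2 * q - 1)) < \<kappa>"
    and s_gain: "s * sqrt (1 + (s powr (q - 1))\<^sup>2) + \<kappa> * s powr (2 * q - 1) \<le> integral {0..s} ?len"
    using eventually_happens'[OF trivial_limit_at_right_real] by blast
  define m where "m = s powr (q - 1)"
  have "real a * (q - 1) = real (b - a)"
    using assms(1,2) by (simp add: q of_nat_diff right_diff_distrib)
  then have "m ^ a = s powr (real (b - a))"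
    using s by (simp add: m_def powr_power)
  then have "m ^ a = s ^ (b - a)"
    using s by (simp add: powr_realpow)
  with s(1) assms(2) obtain E where "0 \<le> E" "E \<le> s ^ (2 * b + 1)"
    and seg: "reaches (P_poly a b) (vector [0, 0, 0]) (vector [m * s, s, E]) (s * sqrt (1 + m\<^sup>2))"
    using reaches_along_segment[of s a b m] by (metis less_imp_le)
  have "m * s = s powr q"
    using s powr_add[of s "q - 1" 1] by (simp add: m_def)
  have lifted: "reaches (P_poly a b) (vector [s powr q, s, E]) (vector [A, \<epsilon>, E]) (integral {s..\<epsilon>} ?len)"
    unfolding A_def using s on_curve by (intro reaches_along_power_curve P_poly_continuous) auto
  have "(s powr ?\<mu>) ^ 3 = s powr real (2 * b + 1)"
    using s by (simp add: powr_power add_divide_distrib add.commute)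
  also have "\<dots> = s ^ (2 * b + 1)"
    using s(1) by (rule powr_realpow)
  finally have "(A ^ (a - 1))\<^sup>2 * (K * s powr ?\<mu>) ^ 3 = s ^ (2 * b + 1)"
    using \<open>0 < A\<close> \<open>K ^ 3 = _\<close> by (simp add: power_mult_distrib)
  then obtain r where "0 \<le> r" "r \<le> K * s powr ?\<mu>"
    and loop: "reaches (P_poly a b) (vector [A, \<epsilon>, E]) (vector [A, \<epsilon>, 0]) (4 * r)"
    using reaches_by_square_loop[of a A \<epsilon> b "K * s powr ?\<mu>" E] assms(1) \<open>0 < A\<close> \<open>0 < K\<close> r0 s
      on_curve[of \<epsilon>] \<open>0 < \<epsilon>\<close> \<open>0 \<le> E\<close> \<open>E \<le> _\<close> unfolding A_def by auto
  have "reaches (P_poly a b) (vector [0, 0, 0]) (vector [A, \<epsilon>, 0])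
      (s * sqrt (1 + m\<^sup>2) + integral {s..\<epsilon>} ?len + 4 * r)"
    using reaches_trans[OF reaches_trans[OF seg[unfolded \<open>m * s = _\<close>] lifted] loop] .
  moreover have "(vector [0, 0, 0] :: real ^ 3) = power_curve q 0" "vector [A, \<epsilon>, 0] = power_curve q \<epsilon>"
    by (simp_all add: power_curve_def A_def)
  moreover have "power_curve q 0 \<noteq> power_curve q \<epsilon>"
    using \<open>0 < \<epsilon>\<close> power_curve_nth(2) by (metis less_irrefl)
  ultimately obtain \<tau>' \<eta>' u' where "horizontal (P_poly a b) \<tau>' \<eta>' u'" "\<eta>' 0 = power_curve q 0"
      "\<eta>' \<tau>' = power_curve q \<epsilon>"
    and len': "sR_length \<tau>' u' = s * sqrt (1 + m\<^sup>2) + integral {s..\<epsilon>} ?len + 4 * r"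
    using reaches_imp_horizontal by metis
  moreover obtain u where "horizontal (P_poly a b) \<epsilon> (power_curve q) u" and
    "\<And>\<tau>' \<eta>' u'. horizontal (P_poly a b) \<tau>' \<eta>' u' \<Longrightarrow> \<eta>' 0 = power_curve q 0 \<Longrightarrow>
      \<eta>' \<tau>' = power_curve q \<epsilon> \<Longrightarrow> sR_length \<epsilon> u \<le> sR_length \<tau>' u'"
    using min unfolding length_minimizing_def by blast
  moreover have "horizontal (P_poly a b) \<epsilon> (power_curve q) (power_control q)"
    using \<open>1 < q\<close> assms by (intro horizontal_power_curve) (auto simp: P_poly_power_curve)
  ultimately have "sR_length \<epsilon> (power_control q) \<le> sR_length \<tau>' u'"
    using sR_length_cong by metis
  moreover have "sR_length \<epsilon> (power_control q) = integral {0..\<epsilon>} ?len"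
    using norm_power_control_le[OF \<open>1 < q\<close>] power_length_integrable[OF \<open>1 < q\<close>, of 0 \<epsilon>]
    by (intro sR_length_eq_has_integral) (auto simp: integrable_integral)
  moreover have "integral {0..\<epsilon>} ?len = integral {0..s} ?len + integral {s..\<epsilon>} ?len"
    using s power_length_integrable[OF \<open>1 < q\<close>, of 0 \<epsilon>]
    by (intro Henstock_Kurzweil_Integration.integral_combine[symmetric]) auto
  moreover have "4 * r < \<kappa> * s powr (2 * q - 1)"
  proof -
    have "s powr ?\<mu> = s powr (?\<mu> - (2 * q - 1)) * s powr (2 * q - 1)"
      by (simp add: powr_add[symmetric])
    then have "4 * r \<le> 4 * K * s powr (?\<mu> - (2 * q - 1)) * s powr (2 * q - 1)"
      using \<open>r \<le> _\<close> by simp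
    also have "\<dots> < \<kappa> * s powr (2 * q - 1)"
      using s_cost s by (intro mult_strict_right_mono) auto
    finally show ?thesis .
  qed
  ultimately show False
    using s_gain len' by (simp add: m_def)
qed

theorem corollary1p4:
  fixes a b :: nat and q \<epsilon> :: real
  assumes "(3 \<le> a \<and> a < b) \<or> (a = 2 \<and> b = 3)"
    and "q = real b / real a"
    and "0 < \<epsilon>"
  shows "strictly_abnormal (P_poly a b) \<epsilon> (power_curve q) \<and>
         C1_rigid (P_poly a b) \<epsilon> (power_curve q) \<and>
         \<not> length_minimizing (P_poly a b) \<epsilon> (power_curve q)"
proof (intro conjI)
  have ab: "0 < a" "a < b"
    using assms(1) by auto
  then have "1 < q"
    using assms(2) by simp
  then show "strictly_abnormal (P_poly a b) \<epsilon> (power_curve q)"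
    using ab assms(2,3)
    by (intro strictly_abnormal_power_curve) (auto simp: P_poly_power_curve P_poly_differentiable)
  show "C1_rigid (P_poly a b) \<epsilon> (power_curve q)"
    by (rule C1_rigid_power_curve[OF ab assms(2,3)])
  \<comment> \<open>For \<open>a \<ge> 3\<close> already \<open>2 q \<le> 2 b / 3\<close>; for \<open>a = 2\<close> the inequality says \<open>b < 4\<close>.\<close>
  have "2 * q - 1 < (2 * real b + 1) / 3"
  proof (cases "a = 2")
    case True
    then show ?thesis
      using assms(1,2) by simp
  next
    case False
    then have "q \<le> real b / 3"
      unfolding assms(2) using assms(1) by (intro divide_left_mono) auto
    then show ?thesis
      by simp
  qed
  then show "\<not> length_minimizing (P_poly a b) \<epsilon> (power_curve q)"
    by (rule not_length_minimizing_power_curve[OF ab assms(2,3)])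
qed

end
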